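(* Symmetric enhanced Leibniz algebras (sELAs) $(t\colon \mathbb{W}\to\mathbb{V},[\cdot,\cdot],\circ)$ are in one-to-one correspondence (up to isomorphism) with data consisting of a Leibniz couple $\mathbb{V}\supset\mathfrak{i}$, a vector space $\mathbb{U}$, and a cohomology class $[\Delta]\in H^2_{\mathrm{d}}(\mathbb{V})\otimes\mathbb{U}$ (i.e. a degree-2 class, with values in $\mathbb{U}$, of the complex with differential $\mathrm{d}$ described in the context) satisfying $\Delta|_{S^2\mathfrak{i}}=0$. Precisely: (1) Given an sELA, the data are $\mathfrak{i}:=\operatorname{im}(t)$, $\mathbb{U}:=\ker(t)$, and the class $[\Delta]$ of $\Delta(u,v):=u\circ v-\tfrac12\sigma([u,v]+[v,u])$, where $\sigma\colon\operatorname{im}(t)\to\mathbb{W}$ is any linear map with $t\circ\sigma=\mathrm{id}_{\operatorname{im}(t)}$. Then $\mathbb{V}\supset\operatorname{im}(t)$ is a Leibniz couple, $\Delta$ takes values in $\ker(t)$, is a $\mathrm{d}$-cocycle, vanishes on $S^2\mathfrak{i}$, and its class does not depend on the choice of $\sigma$. (2) Conversely, given such data $(\mathbb{V}\supset\mathfrak{i},\mathbb{U},[\Delta])$, put $\mathbb{W}:=\mathbb{U}\oplus\mathfrak{i}$, let $\sigma\colon\mathfrak{i}\to\mathbb{U}\oplus\mathfrak{i}$ be the inclusion of the second summand, let $t\colon\mathbb{U}\oplus\mathfrak{i}\to\mathfrak{i}\subset\mathbb{V}$ be the projection onto $\mathfrak{i}$ viewed as a map into $\mathbb{V}$, choose a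 representative cocycle $\Delta$ of the class, and set $u\circ v:=\tfrac12\sigma([u,v]+[v,u])+\Delta(u,v)$. This is an sELA, and every sELA is isomorphic to the one obtained in this way from its data in (1). (3) Every general (not necessarily symmetric) ELA differs from such a symmetric one (its symmetrization) by the addition of $\beta(u,v)$ to $u\circ v$ for a unique $\beta\in\Lambda^2\mathbb{V}^*\otimes\mathbb{W}$.
   Context: All vector spaces are over a field $\mathbb{K}$ of characteristic different from $2$. A (left) Leibniz algebra $(\mathbb{V},[\cdot,\cdot])$ is a vector space with a bilinear bracket satisfying $[v_1,[v_2,v_3]]=[[v_1,v_2],v_3]+[v_2,[v_1,v_3]]$. An enhanced Leibniz algebra (ELA) $(t\colon\mathbb{W}\to\mathbb{V},[\cdot,\cdot],\circ)$ consists of a left Leibniz algebra $(\mathbb{V},[\cdot,\cdot])$, a vector space $\mathbb{W}$, a linear map $t\colon\mathbb{W}\to\mathbb{V}$, and a bilinear product $\circ\colon\mathbb{V}\times\mathbb{V}\to\mathbb{W}$ such that for all $u,v\in\mathbb{V}$, $w\in\mathbb{W}$: (a) $[t(w),v]=0$; (b) $t(w)\circ t(w)=0$; (c) $u\stackrel{s}{\circ}[v,v]=v\stackrel{s}{\circ}[u,v]$; (d) $[v,v]=t(v\circ v)$; here $u\stackrel{s}{\circ}v:=\tfrac12(u\circ v+v\circ u)$. It is symmetric (an sELA) if $\circ$ is symmetric. The symmetrization of an ELA replaces $\circ$ by $\stackrel{s}{\circ}$. An isomorphism of sELAs is a pair of linear isomorphisms $\varphi\colon\mathbb{W}\to\mathbb{W}'$,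 $\psi\colon\mathbb{V}\to\mathbb{V}'$ with $\psi\circ t=t'\circ\varphi$, $\psi$ a morphism of Leibniz algebras, and $\psi(v_1)\circ'\psi(v_2)=\varphi(v_1\circ v_2)$. For a Leibniz algebra $\mathbb{V}$, $\mathrm{Sq}(\mathbb{V})$ is the linear span of all $[x,x]$, $x\in\mathbb{V}$, and $Z_L(\mathbb{V})=\{x\in\mathbb{V}\mid [x,y]=0\ \forall y\in\mathbb{V}\}$. A Leibniz couple $\mathbb{V}\supset\mathfrak{i}$ is a Leibniz algebra $\mathbb{V}$ with a left ideal $\mathfrak{i}$ (i.e. $[\mathbb{V},\mathfrak{i}]\subset\mathfrak{i}$) such that $\mathrm{Sq}(\mathbb{V})\subset\mathfrak{i}\subset Z_L(\mathbb{V})$. The complex: for a Leibniz algebra $\mathbb{V}$, consider $0\to\mathbb{V}^*\xrightarrow{\mathrm{d}}S^2\mathbb{V}^*\xrightarrow{\mathrm{d}}\mathbb{V}^*\otimes S^2\mathbb{V}^*$, with $\mathrm{d}\delta(u,v)=\tfrac12\delta([u,v])+\tfrac12\delta([v,u])$ for $\delta\in\mathbb{V}^*$, and $\mathrm{d}\Delta(v_0,v_1,v_2)=\Delta([v_0,v_1],v_2)+\Delta(v_1,[v_0,v_2])-\Delta(v_0,[v_1,v_2])-\Delta(v_0,[v_2,v_1])$ for $\Delta\in S^2\mathbb{V}^*$. One has $\mathrm{d}^2=0$; $H^2_{\mathrm{d}}(\mathbb{V})$ is the cohomology at $S^2\mathbb{V}^*$. The same formulas are used for cochains with values in $\mathbb{U}$: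 $\mathbb{U}$-valued 1-cochains are linear maps $\mathbb{V}\to\mathbb{U}$ and 2-cochains are symmetric bilinear maps $\mathbb{V}\times\mathbb{V}\to\mathbb{U}$. The condition $\Delta|_{S^2\mathfrak{i}}=0$ means that $\Delta(m,n)=0$ for all $m,n\in\mathfrak{i}$; since $[\mathfrak{i},\mathbb{V}]=0$, it does not depend on the representative of the class. *)

theory Defs
  imports "HOL-Analysis.Product_Vector" "HOL-Computational_Algebra.Computational_Algebra"
begin

text \<open>
  Conventions.  A Leibniz algebra \<open>V\<close> is carried by a whole type, with scalar multiplication
  \<open>vscale\<close>.  The spaces \<open>W\<close> and \<open>U\<close> are carried by linear subspaces (\<open>wcarrier\<close>, \<open>ucarrier\<close>)
  of an ambient vector space, because \<open>U = ker t\<close> and \<open>W = U \<oplus> i\<close> are not types.  All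
  structure on them is only required on these subspaces.
\<close>

definition linear_on :: "('k::field \<Rightarrow> 'a::ab_group_add \<Rightarrow> 'a) \<Rightarrow> ('k \<Rightarrow> 'b::ab_group_add \<Rightarrow> 'b)
    \<Rightarrow> 'a set \<Rightarrow> 'b set \<Rightarrow> ('a \<Rightarrow> 'b) \<Rightarrow> bool"
  where "linear_on s1 s2 A B f \<longleftrightarrow>
    f ` A \<subseteq> B \<and>
    (\<forall>x\<in>A. \<forall>y\<in>A. f (x + y) = f x + f y) \<and>
    (\<forall>c. \<forall>x\<in>A. f (s1 c x) = s2 c (f x))"

definition linear_iso_on :: "('k::field \<Rightarrow> 'a::ab_group_add \<Rightarrow> 'a) \<Rightarrow> ('k \<Rightarrow> 'b::ab_group_add \<Rightarrow> 'b)
    \<Rightarrow> 'a set \<Rightarrow> 'b set \<Rightarrow> ('a \<Rightarrow> 'b) \<Rightarrow> bool"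
  where "linear_iso_on s1 s2 A B f \<longleftrightarrow> linear_on s1 s2 A B f \<and> bij_betw f A B"

definition bilinear_into :: "('k::field \<Rightarrow> 'a::ab_group_add \<Rightarrow> 'a) \<Rightarrow> ('k \<Rightarrow> 'b::ab_group_add \<Rightarrow> 'b)
    \<Rightarrow> 'b set \<Rightarrow> ('a \<Rightarrow> 'a \<Rightarrow> 'b) \<Rightarrow> bool"
  where "bilinear_into s1 s2 B f \<longleftrightarrow>
    (\<forall>u v. f u v \<in> B) \<and>
    (\<forall>u. Vector_Spaces.linear s1 s2 (\<lambda>v. f u v)) \<and>
    (\<forall>v. Vector_Spaces.linear s1 s2 (\<lambda>u. f u v))"


section \<open>Leibniz algebras and Leibniz couples\<close>

record ('k, 'v) leibniz =
  vscale :: "'k \<Rightarrow> 'v \<Rightarrow> 'v"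
  bracket :: "'v \<Rightarrow> 'v \<Rightarrow> 'v"

definition leibniz_algebra :: "('k::field, 'v::ab_group_add, 'z) leibniz_scheme \<Rightarrow> bool"
  where "leibniz_algebra L \<longleftrightarrow>
    vector_space (vscale L) \<and>
    bilinear_into (vscale L) (vscale L) UNIV (bracket L) \<and>
    (\<forall>x y z. bracket L x (bracket L y z)
       = bracket L (bracket L x y) z + bracket L y (bracket L x z))"

definition Sq :: "('k::field, 'v::ab_group_add, 'z) leibniz_scheme \<Rightarrow> 'v set"
  where "Sq L = module.span (vscale L) {bracket L x x | x. True}"

definition left_center :: "('k::field, 'v::ab_group_add, 'z) leibniz_scheme \<Rightarrow> 'v set"
  where "left_center L = {x. \<forall>y. bracket L x y = 0}"

definition leibniz_couple :: "('k::field, 'v::ab_group_add, 'z) leibniz_scheme \<Rightarrow> 'v set \<Rightarrow> bool"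
  where "leibniz_couple L I \<longleftrightarrow>
    leibniz_algebra L \<and>
    module.subspace (vscale L) I \<and>
    (\<forall>v. \<forall>x\<in>I. bracket L v x \<in> I) \<and>
    Sq L \<subseteq> I \<and> I \<subseteq> left_center L"


section \<open>The complex of symmetric cochains with values in \<open>U\<close>\<close>

definition cochains1 :: "('k::field, 'v::ab_group_add, 'z) leibniz_scheme
    \<Rightarrow> ('k \<Rightarrow> 'u::ab_group_add \<Rightarrow> 'u) \<Rightarrow> 'u set \<Rightarrow> ('v \<Rightarrow> 'u) set"
  where "cochains1 L s U = {\<delta>. Vector_Spaces.linear (vscale L) s \<delta> \<and> range \<delta> \<subseteq> U}"

definition cochains2 :: "('k::field, 'v::ab_group_add, 'z) leibniz_scheme
    \<Rightarrow> ('k \<Rightarrow> 'u::ab_group_add \<Rightarrow> 'u) \<Rightarrow> 'u set \<Rightarrow> ('v \<Rightarrow> 'v \<Rightarrow> 'u) set"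
  where "cochains2 L s U =
    {\<Delta>. bilinear_into (vscale L) s U \<Delta> \<and> (\<forall>u v. \<Delta> u v = \<Delta> v u)}"

definition d1 :: "('k::field, 'v::ab_group_add, 'z) leibniz_scheme
    \<Rightarrow> ('k \<Rightarrow> 'u::ab_group_add \<Rightarrow> 'u) \<Rightarrow> ('v \<Rightarrow> 'u) \<Rightarrow> 'v \<Rightarrow> 'v \<Rightarrow> 'u"
  where "d1 L s \<delta> u v = s (1/2) (\<delta> (bracket L u v)) + s (1/2) (\<delta> (bracket L v u))"

definition d2 :: "('k::field, 'v::ab_group_add, 'z) leibniz_scheme
    \<Rightarrow> ('v \<Rightarrow> 'v \<Rightarrow> 'u::ab_group_add) \<Rightarrow> 'v \<Rightarrow> 'v \<Rightarrow> 'v \<Rightarrow> 'u"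
  where "d2 L \<Delta> v0 v1 v2 =
    \<Delta> (bracket L v0 v1) v2 + \<Delta> v1 (bracket L v0 v2)
    - \<Delta> v0 (bracket L v1 v2) - \<Delta> v0 (bracket L v2 v1)"

definition cocycles2 :: "('k::field, 'v::ab_group_add, 'z) leibniz_scheme
    \<Rightarrow> ('k \<Rightarrow> 'u::ab_group_add \<Rightarrow> 'u) \<Rightarrow> 'u set \<Rightarrow> ('v \<Rightarrow> 'v \<Rightarrow> 'u) set"
  where "cocycles2 L s U = {\<Delta> \<in> cochains2 L s U. \<forall>v0 v1 v2. d2 L \<Delta> v0 v1 v2 = 0}"

definition cohomologous :: "('k::field, 'v::ab_group_add, 'z) leibniz_scheme
    \<Rightarrow> ('k \<Rightarrow> 'u::ab_group_add \<Rightarrow> 'u) \<Rightarrow> 'u set \<Rightarrow> ('v \<Rightarrow> 'v \<Rightarrow> 'u) rel"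
  where "cohomologous L s U =
    {(\<Delta>, \<Delta>'). \<Delta> \<in> cocycles2 L s U \<and> \<Delta>' \<in> cocycles2 L s U \<and>
       (\<exists>\<delta>\<in>cochains1 L s U. \<forall>u v. \<Delta>' u v - \<Delta> u v = d1 L s \<delta> u v)}"

definition coh_class :: "('k::field, 'v::ab_group_add, 'z) leibniz_scheme
    \<Rightarrow> ('k \<Rightarrow> 'u::ab_group_add \<Rightarrow> 'u) \<Rightarrow> 'u set \<Rightarrow> ('v \<Rightarrow> 'v \<Rightarrow> 'u) \<Rightarrow> ('v \<Rightarrow> 'v \<Rightarrow> 'u) set"
  where "coh_class L s U \<Delta> = cohomologous L s U `` {\<Delta>}"

definition H2 :: "('k::field, 'v::ab_group_add, 'z) leibniz_scheme
    \<Rightarrow> ('k \<Rightarrow> 'u::ab_group_add \<Rightarrow> 'u) \<Rightarrow> 'u set \<Rightarrow> ('v \<Rightarrow> 'v \<Rightarrow> 'u) set set"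
  where "H2 L s U = cocycles2 L s U // cohomologous L s U"


section \<open>Enhanced Leibniz algebras\<close>

text \<open>\<open>anchor\<close> is the map \<open>t\<close>, \<open>eprod\<close> the product \<open>\<circ>\<close>.\<close>

record ('k, 'v, 'w) enhanced = "('k, 'v) leibniz" +
  wscale :: "'k \<Rightarrow> 'w \<Rightarrow> 'w"
  wcarrier :: "'w set"
  anchor :: "'w \<Rightarrow> 'v"
  eprod :: "'v \<Rightarrow> 'v \<Rightarrow> 'w"

definition eprod_sym :: "('k::field, 'v::ab_group_add, 'w::ab_group_add) enhanced \<Rightarrow> 'v \<Rightarrow> 'v \<Rightarrow> 'w"
  where "eprod_sym A u v = wscale A (1/2) (eprod A u v + eprod A v u)"

definition ELA :: "('k::field, 'v::ab_group_add, 'w::ab_group_add) enhanced \<Rightarrow> bool"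
  where "ELA A \<longleftrightarrow>
    leibniz_algebra A \<and>
    vector_space (wscale A) \<and> module.subspace (wscale A) (wcarrier A) \<and>
    linear_on (wscale A) (vscale A) (wcarrier A) UNIV (anchor A) \<and>
    bilinear_into (vscale A) (wscale A) (wcarrier A) (eprod A) \<and>
    (\<forall>w\<in>wcarrier A. \<forall>v. bracket A (anchor A w) v = 0) \<and>
    (\<forall>w\<in>wcarrier A. eprod A (anchor A w) (anchor A w) = 0) \<and>
    (\<forall>u v. eprod_sym A u (bracket A v v) = eprod_sym A v (bracket A u v)) \<and>
    (\<forall>v. bracket A v v = anchor A (eprod A v v))"

definition sELA :: "('k::field, 'v::ab_group_add, 'w::ab_group_add) enhanced \<Rightarrow> bool"
  where "sELA E \<longleftrightarrow> ELA E \<and> (\<forall>u v. eprod E u v = eprod E v u)"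

definition symmetrization :: "('k::field, 'v::ab_group_add, 'w::ab_group_add) enhanced
    \<Rightarrow> ('k, 'v, 'w) enhanced"
  where "symmetrization A = A\<lparr>eprod := eprod_sym A\<rparr>"

definition sELA_iso :: "('k::field, 'v::ab_group_add, 'w::ab_group_add) enhanced
    \<Rightarrow> ('k, 'v'::ab_group_add, 'w'::ab_group_add) enhanced \<Rightarrow> bool"
  where "sELA_iso E E' \<longleftrightarrow> (\<exists>\<phi> \<psi>.
    linear_iso_on (wscale E) (wscale E') (wcarrier E) (wcarrier E') \<phi> \<and>
    linear_iso_on (vscale E) (vscale E') UNIV UNIV \<psi> \<and>
    (\<forall>w\<in>wcarrier E. \<psi> (anchor E w) = anchor E' (\<phi> w)) \<and>
    (\<forall>x y. \<psi> (bracket E x y) = bracket E' (\<psi> x) (\<psi> y)) \<and>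
    (\<forall>x y. eprod E' (\<psi> x) (\<psi> y) = \<phi> (eprod E x y)))"

definition im_anchor :: "('k, 'v, 'w) enhanced \<Rightarrow> 'v set"
  where "im_anchor E = anchor E ` wcarrier E"

definition ker_anchor :: "('k, 'v::ab_group_add, 'w) enhanced \<Rightarrow> 'w set"
  where "ker_anchor E = {w \<in> wcarrier E. anchor E w = 0}"

definition alternating_forms :: "('k::field, 'v::ab_group_add, 'w::ab_group_add) enhanced
    \<Rightarrow> ('v \<Rightarrow> 'v \<Rightarrow> 'w) set"
  where "alternating_forms A =
    {\<beta>. bilinear_into (vscale A) (wscale A) (wcarrier A) \<beta> \<and> (\<forall>v. \<beta> v v = 0)}"


section \<open>The classifying data\<close>

record ('k, 'v, 'u) couple_data = "('k, 'v) leibniz" +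
  ideal :: "'v set"
  uscale :: "'k \<Rightarrow> 'u \<Rightarrow> 'u"
  ucarrier :: "'u set"
  class2 :: "('v \<Rightarrow> 'v \<Rightarrow> 'u) set"

definition classifying_data :: "('k::field, 'v::ab_group_add, 'u::ab_group_add) couple_data \<Rightarrow> bool"
  where "classifying_data D \<longleftrightarrow>
    leibniz_couple D (ideal D) \<and>
    vector_space (uscale D) \<and> module.subspace (uscale D) (ucarrier D) \<and>
    class2 D \<in> H2 D (uscale D) (ucarrier D) \<and>
    (\<forall>\<Delta>\<in>class2 D. \<forall>m\<in>ideal D. \<forall>n\<in>ideal D. \<Delta> m n = 0)"

text \<open>
  Isomorphic data: an isomorphism \<open>\<psi>\<close> of Leibniz algebras carrying one ideal onto the other,
  and a linear isomorphism \<open>\<chi>\<close> of the coefficient spaces, such that the induced map on cocycles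
  carries one cohomology class (a set of cocycles) onto the other.
\<close>

definition data_iso :: "('k::field, 'v::ab_group_add, 'u::ab_group_add) couple_data
    \<Rightarrow> ('k, 'v'::ab_group_add, 'u'::ab_group_add) couple_data \<Rightarrow> bool"
  where "data_iso D D' \<longleftrightarrow> (\<exists>\<psi> \<chi>.
    linear_iso_on (vscale D) (vscale D') UNIV UNIV \<psi> \<and>
    (\<forall>x y. \<psi> (bracket D x y) = bracket D' (\<psi> x) (\<psi> y)) \<and>
    \<psi> ` ideal D = ideal D' \<and>
    linear_iso_on (uscale D) (uscale D') (ucarrier D) (ucarrier D') \<chi> \<and>
    (\<lambda>\<Delta> x y. \<chi> (\<Delta> (inv \<psi> x) (inv \<psi> y))) ` class2 D = class2 D')"


section \<open>From symmetric enhanced Leibniz algebras to data and back\<close>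

definition sections :: "('k::field, 'v::ab_group_add, 'w::ab_group_add) enhanced \<Rightarrow> ('v \<Rightarrow> 'w) set"
  where "sections E =
    {\<sigma>. linear_on (vscale E) (wscale E) (im_anchor E) (wcarrier E) \<sigma> \<and>
        (\<forall>x\<in>im_anchor E. anchor E (\<sigma> x) = x)}"

definition Delta_of :: "('k::field, 'v::ab_group_add, 'w::ab_group_add) enhanced
    \<Rightarrow> ('v \<Rightarrow> 'w) \<Rightarrow> 'v \<Rightarrow> 'v \<Rightarrow> 'w"
  where "Delta_of E \<sigma> u v = eprod E u v - wscale E (1/2) (\<sigma> (bracket E u v + bracket E v u))"

text \<open>
  The class below is the common value over all sections; that it exists and is unique is part
  of the theorem.
\<close>

definition data_of :: "('k::field, 'v::ab_group_add, 'w::ab_group_add) enhanced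
    \<Rightarrow> ('k, 'v, 'w) couple_data"
  where "data_of E =
    \<lparr>vscale = vscale E, bracket = bracket E,
     ideal = im_anchor E, uscale = wscale E, ucarrier = ker_anchor E,
     class2 = (THE c. \<exists>\<sigma>\<in>sections E. c = coh_class E (wscale E) (ker_anchor E) (Delta_of E \<sigma>))\<rparr>"

definition sELA_of :: "('k::field, 'v::ab_group_add, 'u::ab_group_add) couple_data
    \<Rightarrow> ('v \<Rightarrow> 'v \<Rightarrow> 'u) \<Rightarrow> ('k, 'v, 'u \<times> 'v) enhanced"
  where "sELA_of D \<Delta> =
    (let s = module_prod.scale (uscale D) (vscale D); \<sigma> = (\<lambda>x. (0, x)) in
     \<lparr>vscale = vscale D, bracket = bracket D,
      wscale = s, wcarrier = ucarrier D \<times> ideal D, anchor = snd,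
      eprod = (\<lambda>u v. s (1/2) (\<sigma> (bracket D u v + bracket D v u)) + (\<Delta> u v, 0))\<rparr>)"

end

theory Submission
  imports Defs
begin

text \<open>
  The class of an sELA \<open>E\<close> is exactly the set of all cocycles \<open>Delta_of E \<sigma>\<close>, where \<open>\<sigma>\<close> runs through
  the sections of \<open>t\<close>: two sections differ by a linear map \<open>im t \<rightarrow> ker t\<close>, which extends to a
  cochain on all of \<open>V\<close>, and subtracting a cochain from a section gives a section again.  Hence an
  isomorphism of data matches \<open>Delta_of E \<sigma>\<close> with \<open>Delta_of E' \<sigma>'\<close> for suitable sections, and on
  the splittings \<open>W = ker t \<oplus> \<sigma> (im t)\<close> and \<open>W' = ker t' \<oplus> \<sigma>' (im t')\<close> it assembles to an
  isomorphism of sELAs.  The round trip from an sELA to itself and the compatibility of the inverse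
  construction with isomorphisms then follow formally from the round trip on data.
\<close>

section \<open>Halving in characteristic different from 2\<close>

lemma two_neq_zero_if_CHAR:
  assumes "CHAR('k::field) \<noteq> 2"
  shows "(2::'k) \<noteq> 0"
proof
  assume "(2::'k) = 0"
  then have "CHAR('k) dvd 2"
    using of_nat_eq_0_iff_char_dvd[where ?'a = 'k and n = 2] by simp
  then have "CHAR('k) = 1 \<or> CHAR('k) = 2"
    using two_is_prime_nat prime_nat_iff by blast
  then show False
    using assms CHAR_not_1'[where ?'a = 'k] by simp
qed

text \<open>If \<open>2 = 0\<close>, the convention for division by zero makes \<open>1/2\<close>
  equal to \<open>0\<close>, so \<open>1/2\<close> is a half only under this assumption. Every later
  cancellation of a doubled vector goes through this rule.\<close>

lemma (in vector_space) scale_half_double: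
  assumes "(2::'a) \<noteq> 0"
  shows "scale (1/2) (x + x) = x"
proof -
  have "scale (1/2) (x + x) = scale (1/2 + 1/2) x"
    by (simp only: scale_left_distrib scale_right_distrib)
  also have "1/2 + 1/2 = (1::'a)"
    using assms by (metis one_add_one div_self add_divide_distrib)
  finally show ?thesis by simp
qed

section \<open>Maps that are linear on a subspace\<close>

lemma linear_onD:
  assumes "linear_on s1 s2 A B f"
  shows "x \<in> A \<Longrightarrow> f x \<in> B"
    and "x \<in> A \<Longrightarrow> y \<in> A \<Longrightarrow> f (x + y) = f x + f y"
    and "x \<in> A \<Longrightarrow> f (s1 c x) = s2 c (f x)"
  using assms unfolding linear_on_def by auto

lemma linear_on_zero:
  assumes "linear_on s1 s2 A B f" "0 \<in> A"
  shows "f 0 = 0"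
  using linear_onD(2)[OF assms(1) assms(2) assms(2)] by simp

lemma linear_on_diff:
  assumes "linear_on s1 s2 A B f" "vector_space s1" "module.subspace s1 A" "x \<in> A" "y \<in> A"
  shows "f (x - y) = f x - f y"
proof -
  interpret vector_space s1 by fact
  have "f (x - y) + f y = f x"
    using linear_onD(2)[OF assms(1) subspace_diff[OF assms(3-5)] assms(5)] by simp
  then show ?thesis by (simp add: algebra_simps)
qed

lemma linear_on_comp:
  assumes "linear_on s1 s2 A B f" "linear_on s2 s3 B C g"
  shows "linear_on s1 s3 A C (\<lambda>x. g (f x))"
  using assms unfolding linear_on_def image_subset_iff by simp

lemma linear_imp_linear_on:
  assumes "Vector_Spaces.linear s1 s2 f" "f ` A \<subseteq> B"
  shows "linear_on s1 s2 A B f"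
  using assms unfolding linear_on_def Vector_Spaces.linear_iff by blast

lemma linear_iso_on_comp:
  assumes "linear_iso_on s1 s2 A B f" "linear_iso_on s2 s3 B C g"
  shows "linear_iso_on s1 s3 A C (\<lambda>x. g (f x))"
  using assms linear_on_comp[of s1 s2 A B f s3 C g] bij_betw_trans[of f A B g C]
  by (simp add: linear_iso_on_def comp_def)

lemma linear_iso_on_inv:
  assumes "linear_iso_on s1 s2 A B f" "vector_space s1" "module.subspace s1 A"
  shows "linear_iso_on s2 s1 B A (inv_into A f)"
proof -
  interpret vector_space s1 by fact
  let ?g = "inv_into A f"
  have lin: "linear_on s1 s2 A B f" and bij: "bij_betw f A B"
    using assms by (auto simp: linear_iso_on_def)
  have gA: "?g y \<in> A" and fg: "f (?g y) = y" if "y \<in> B" for y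
    using that bij by (auto simp: bij_betw_inv_into_right intro: bij_betw_apply[OF bij_betw_inv_into])
  have gf: "?g (f x) = x" if "x \<in> A" for x
    using that bij by (simp add: bij_betw_inv_into_left)
  have "?g (x + y) = ?g x + ?g y" if "x \<in> B" "y \<in> B" for x y
    using linear_onD(2)[OF lin gA gA, OF that] gf[OF subspace_add[OF assms(3) gA gA, OF that]]
    by (simp add: fg that)
  moreover have "?g (s2 c x) = s1 c (?g x)" if "x \<in> B" for c x
    using linear_onD(3)[OF lin gA, OF that] gf[OF subspace_scale[OF assms(3) gA, OF that]]
    by (simp add: fg that)
  ultimately have "linear_on s2 s1 B A ?g"
    using gA unfolding linear_on_def by auto
  then show ?thesis
    using bij_betw_inv_into[OF bij] by (simp add: linear_iso_on_def)
qed

section \<open>Extension of linear maps with control of the range\<close>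

lemma linear_on_extend_basis:
  assumes vs: "vector_space s1" "vector_space s2"
    and B: "module.subspace s2 B" and ind: "\<not> module.dependent s1 S"
    and fS: "f ` S \<subseteq> B"
  shows "\<exists>g. Vector_Spaces.linear s1 s2 g \<and> range g \<subseteq> B \<and> (\<forall>x\<in>S. g x = f x)"
proof -
  interpret vector_space_pair s1 s2
    using vs by (simp add: vector_space_pair_def)
  obtain g where g: "Vector_Spaces.linear s1 s2 g" "\<forall>x\<in>S. g x = f x" "range g = vs2.span (f ` S)"
    using linear_independent_extend_subspace[OF ind] by blast
  \<comment> \<open>The range of \<open>g\<close> is the span of the values prescribed on
    \<open>S\<close>, and the subspace \<open>B\<close> contains it.\<close>
  have "range g \<subseteq> B"
    using g(3) vs2.span_minimal[OF _ B, of "f ` S"] fS by auto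
  then show ?thesis
    using g by (intro exI[of _ g] conjI)
qed

text \<open>Serves to turn a difference of two sections, linear only on \<open>im t\<close>, into a
  cochain on all of \<open>V\<close> with values still in \<open>ker t\<close>. A maximal
  independent subset of \<open>I\<close> spans \<open>I\<close>, and the extension from it agrees
  with \<open>f\<close> on the span.\<close>

lemma linear_on_extend:
  assumes vs: "vector_space s1" "vector_space s2"
    and I: "module.subspace s1 I" and B: "module.subspace s2 B"
    and f: "linear_on s1 s2 I B f"
  shows "\<exists>g. Vector_Spaces.linear s1 s2 g \<and> range g \<subseteq> B \<and> (\<forall>x\<in>I. g x = f x)"
proof -
  interpret v1: vector_space s1 by fact
  interpret v2: vector_space s2 by fact
  obtain S where S: "S \<subseteq> I" "v1.independent S" "I \<subseteq> v1.span S"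
    using v1.maximal_independent_subset by blast
  have fS: "f ` S \<subseteq> B"
    using linear_onD(1)[OF f] S(1) by blast
  obtain g where g: "Vector_Spaces.linear s1 s2 g" "range g \<subseteq> B" "\<And>x. x \<in> S \<Longrightarrow> g x = f x"
    using linear_on_extend_basis[OF vs B S(2) fS] by blast
  \<comment> \<open>Membership in \<open>I\<close> is carried through the induction because
    \<open>f\<close> respects sums and multiples only of elements of \<open>I\<close>.\<close>
  have "x \<in> I \<and> g x = f x" if "x \<in> v1.span S" for x
    using that
  proof (induction rule: v1.span_induct_alt)
    case base
    show ?case
      using linear_on_zero[OF f v1.subspace_0[OF I]] v1.subspace_0[OF I]
        linear_on_zero[OF linear_imp_linear_on[OF g(1) subset_UNIV] UNIV_I] by simp
  next
    case (step c x y)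
    then have "x \<in> I" "y \<in> I" "g x = f x" "g y = f y"
      using S(1) g(3) by auto
    then show ?case
      using g(1) linear_onD(2,3)[OF f] v1.subspace_add[OF I] v1.subspace_scale[OF I]
      by (simp add: Vector_Spaces.linear_iff)
  qed
  then show ?thesis
    using g S(3) by (intro exI[of _ g]) auto
qed

text \<open>Supplies the sections of \<open>t\<close>: preimages are chosen on a basis of the image
  and extended linearly, with values kept in \<open>A\<close> so that the linearity of
  \<open>f\<close> on \<open>A\<close> applies to them.\<close>

lemma linear_on_right_inverse:
  assumes vs: "vector_space s1" "vector_space s2"
    and A: "module.subspace s1 A" and f: "linear_on s1 s2 A UNIV f"
  shows "\<exists>g. linear_on s2 s1 (f ` A) A g \<and> (\<forall>x\<in>f ` A. f (g x) = x)"
proof -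
  interpret v1: vector_space s1 by fact
  interpret v2: vector_space s2 by fact
  obtain S where S: "S \<subseteq> f ` A" "v2.independent S" "f ` A \<subseteq> v2.span S"
    using v2.maximal_independent_subset by blast
  have invS: "inv_into A f ` S \<subseteq> A"
    using S(1) by (auto intro: inv_into_into)
  obtain g where g: "Vector_Spaces.linear s2 s1 g" "range g \<subseteq> A"
      "\<And>x. x \<in> S \<Longrightarrow> g x = inv_into A f x"
    using linear_on_extend_basis[OF vs(2,1) A S(2) invS] by blast
  have "f (g x) = x" if "x \<in> v2.span S" for x
    using that
  proof (induction rule: v2.span_induct_alt)
    case base
    have "g 0 = 0"
      by (rule linear_on_zero[OF linear_imp_linear_on[OF g(1) subset_UNIV] UNIV_I])
    then show ?case
      using linear_on_zero[OF f v1.subspace_0[OF A]] by simp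
  next
    case (step c x y)
    have "f (g x) = x"
      using f_inv_into_f[of x f A] step(1) S(1) g(3)[OF step(1)] by auto
    moreover have "g x \<in> A" "g y \<in> A" using g(2) by auto
    ultimately show ?case
      using g(1) step(2) linear_onD(2,3)[OF f] v1.subspace_scale[OF A]
      by (simp add: Vector_Spaces.linear_iff)
  qed
  moreover have "linear_on s2 s1 (f ` A) A g"
    using g by (intro linear_imp_linear_on) auto
  ultimately show ?thesis
    using S(3) by (intro exI[of _ g]) auto
qed

lemma bilinear_intoD:
  assumes "bilinear_into s1 s2 B f"
  shows "f u v \<in> B"
    and "f (u + u') v = f u v + f u' v" and "f u (v + v') = f u v + f u v'"
    and "f (s1 c u) v = s2 c (f u v)" and "f u (s1 c v) = s2 c (f u v)"
    and "f 0 v = 0" and "f u 0 = 0"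
proof -
  show *: "f u v \<in> B"
    "f (u + u') v = f u v + f u' v" "f u (v + v') = f u v + f u v'"
    "f (s1 c u) v = s2 c (f u v)" "f u (s1 c v) = s2 c (f u v)" for u u' v v' c
    using assms unfolding bilinear_into_def Vector_Spaces.linear_iff by blast+
  show "f 0 v = 0" "f u 0 = 0"
    using *(2)[of 0 0 v] *(3)[of u 0 0] by simp_all
qed

lemma bilinear_intoI:
  assumes "vector_space s1" "vector_space s2"
    and "\<And>u v. f u v \<in> B"
    and "\<And>u u' v. f (u + u') v = f u v + f u' v" "\<And>u v v'. f u (v + v') = f u v + f u v'"
    and "\<And>c u v. f (s1 c u) v = s2 c (f u v)" "\<And>c u v. f u (s1 c v) = s2 c (f u v)"
  shows "bilinear_into s1 s2 B f"
  using assms by (simp add: bilinear_into_def Vector_Spaces.linear_iff)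

section \<open>Leibniz algebras and cohomology classes\<close>

lemma leibniz_algebraD:
  assumes "leibniz_algebra L"
  shows "vector_space (vscale L)"
    and "bilinear_into (vscale L) (vscale L) UNIV (bracket L)"
    and "\<forall>x y z. bracket L x (bracket L y z)
      = bracket L (bracket L x y) z + bracket L y (bracket L x z)"
  by (insert assms, unfold leibniz_algebra_def, elim conjE, assumption)+

text \<open>The complex sees only scalar multiplication and bracket. This rule and its companions
  transfer it between records of different types over the same algebra, such as \<open>E\<close> and
  \<open>data_of E\<close>.\<close>

lemma cocycles2_cong:
  assumes "vscale L = vscale L'" "bracket L = bracket L'"
  shows "cocycles2 L s U = cocycles2 L' s U"
  using assms unfolding cocycles2_def cochains2_def d2_def by simp

lemma cohomologous_cong:
  assumes "vscale L = vscale L'" "bracket L = bracket L'"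
  shows "cohomologous L s U = cohomologous L' s U"
  unfolding cohomologous_def d1_def cochains1_def cocycles2_cong[OF assms] assms ..

lemma H2_cong:
  assumes "vscale L = vscale L'" "bracket L = bracket L'"
  shows "H2 L s U = H2 L' s U"
  unfolding H2_def cocycles2_cong[OF assms] cohomologous_cong[OF assms] ..

lemma leibniz_coupleD:
  assumes "leibniz_couple L I"
  shows "leibniz_algebra L" "module.subspace (vscale L) I" "\<forall>v. \<forall>x\<in>I. bracket L v x \<in> I"
    "Sq L \<subseteq> I" "I \<subseteq> left_center L"
  by (insert assms, unfold leibniz_couple_def, elim conjE, assumption)+

lemma leibniz_algebra_cong:
  assumes "vscale L = vscale L'" "bracket L = bracket L'"
  shows "leibniz_algebra L = leibniz_algebra L'"
  unfolding leibniz_algebra_def assms ..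

lemma leibniz_couple_cong:
  assumes "vscale L = vscale L'" "bracket L = bracket L'"
  shows "leibniz_couple L I = leibniz_couple L' I"
  unfolding leibniz_couple_def leibniz_algebra_cong[OF assms] Sq_def left_center_def assms ..

text \<open>The 1-cochains contain zero and are closed under negation and addition, and
  \<open>d1\<close> respects these operations; this gives reflexivity, symmetry and transitivity in
  turn.\<close>

lemma equiv_cohomologous:
  assumes L: "vector_space (vscale L)" and s: "vector_space s" and U: "module.subspace s U"
  shows "equiv (cocycles2 L s U) (cohomologous L s U)"
proof -
  interpret L: vector_space "vscale L" by fact
  interpret s: vector_space s by fact
  have zero: "(\<lambda>_. 0) \<in> cochains1 L s U"
    using assms s.subspace_0[OF U] by (auto simp: cochains1_def Vector_Spaces.linear_iff)
  have minus: "(\<lambda>x. - \<delta> x) \<in> cochains1 L s U" if "\<delta> \<in> cochains1 L s U" for \<delta>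
    using that assms s.subspace_neg[OF U] by (auto simp: cochains1_def Vector_Spaces.linear_iff)
  have plus: "(\<lambda>x. \<delta> x + \<epsilon> x) \<in> cochains1 L s U"
    if "\<delta> \<in> cochains1 L s U" "\<epsilon> \<in> cochains1 L s U" for \<delta> \<epsilon>
    using that assms s.subspace_add[OF U]
    by (simp add: cochains1_def Vector_Spaces.linear_iff s.scale_right_distrib image_subset_iff)
  have d1_minus: "d1 L s (\<lambda>x. - \<delta> x) u v = - d1 L s \<delta> u v" for \<delta> u v
    by (simp add: d1_def)
  have d1_plus: "d1 L s (\<lambda>x. \<delta> x + \<epsilon> x) u v = d1 L s \<delta> u v + d1 L s \<epsilon> u v" for \<delta> \<epsilon> u v
    by (simp add: d1_def s.scale_right_distrib)
  show ?thesis
  proof (rule equivI)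
    show "refl_on (cocycles2 L s U) (cohomologous L s U)"
      using zero by (auto simp: refl_on_def cohomologous_def d1_def intro!: bexI[of _ "\<lambda>_. 0"])
    show "cohomologous L s U \<subseteq> cocycles2 L s U \<times> cocycles2 L s U"
      by (auto simp: cohomologous_def)
    show "sym (cohomologous L s U)"
    proof (rule symI)
      fix \<Delta> \<Delta>' assume "(\<Delta>, \<Delta>') \<in> cohomologous L s U"
      then obtain \<delta> where *: "\<delta> \<in> cochains1 L s U" "\<forall>u v. \<Delta>' u v - \<Delta> u v = d1 L s \<delta> u v"
        and cc: "\<Delta> \<in> cocycles2 L s U" "\<Delta>' \<in> cocycles2 L s U"
        unfolding cohomologous_def by blast
      have "\<Delta> u v - \<Delta>' u v = d1 L s (\<lambda>x. - \<delta> x) u v" for u v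
        by (simp add: d1_minus flip: *(2)[rule_format])
      then show "(\<Delta>', \<Delta>) \<in> cohomologous L s U"
        using cc minus[OF *(1)] unfolding cohomologous_def by blast
    qed
    show "trans (cohomologous L s U)"
    proof (rule transI)
      fix \<Delta> \<Delta>' \<Delta>'' assume "(\<Delta>, \<Delta>') \<in> cohomologous L s U" "(\<Delta>', \<Delta>'') \<in> cohomologous L s U"
      then obtain \<delta> \<epsilon> where *: "\<delta> \<in> cochains1 L s U" "\<forall>u v. \<Delta>' u v - \<Delta> u v = d1 L s \<delta> u v"
         "\<epsilon> \<in> cochains1 L s U" "\<forall>u v. \<Delta>'' u v - \<Delta>' u v = d1 L s \<epsilon> u v"
        and cc: "\<Delta> \<in> cocycles2 L s U" "\<Delta>'' \<in> cocycles2 L s U"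
        unfolding cohomologous_def by blast
      have "\<Delta>'' u v - \<Delta> u v = d1 L s (\<lambda>x. \<delta> x + \<epsilon> x) u v" for u v
        by (simp add: d1_plus flip: *(2)[rule_format] *(4)[rule_format])
      then show "(\<Delta>, \<Delta>'') \<in> cohomologous L s U"
        using cc plus[OF *(1,3)] unfolding cohomologous_def by blast
    qed
  qed
qed

lemma mem_coh_class_iff:
  "\<Delta>' \<in> coh_class L s U \<Delta> \<longleftrightarrow> \<Delta> \<in> cocycles2 L s U \<and> \<Delta>' \<in> cocycles2 L s U \<and>
    (\<exists>\<delta>\<in>cochains1 L s U. \<forall>u v. \<Delta>' u v - \<Delta> u v = d1 L s \<delta> u v)"
  by (simp add: coh_class_def cohomologous_def)

text \<open>Any member of a class may serve as its representative, since the classes are those of an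
  equivalence relation.\<close>

lemma coh_class_eq:
  assumes "vector_space (vscale L)" "vector_space s" "module.subspace s U"
    and "c \<in> H2 L s U" "\<Delta> \<in> c"
  shows "c = coh_class L s U \<Delta>" "\<Delta> \<in> cocycles2 L s U"
proof -
  note eq = equiv_cohomologous[OF assms(1-3)]
  obtain \<Delta>0 where "\<Delta>0 \<in> cocycles2 L s U" "c = cohomologous L s U `` {\<Delta>0}"
    using assms(4) unfolding H2_def by (rule quotientE)
  then show "c = coh_class L s U \<Delta>" "\<Delta> \<in> cocycles2 L s U"
    using assms(5) equiv_class_eq[OF eq] by (auto simp: coh_class_def cohomologous_def)
qed

lemma coh_class_cong:
  assumes "vscale L = vscale L'" "bracket L = bracket L'"
  shows "coh_class L s U \<Delta> = coh_class L' s U \<Delta>"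
  unfolding coh_class_def cohomologous_cong[OF assms] ..

section \<open>Change of coefficients along a linear map\<close>

lemma cocycles2_map:
  assumes "Vector_Spaces.linear s1 s2 h" "h ` U \<subseteq> U'" "\<Delta> \<in> cocycles2 L s1 U"
  shows "(\<lambda>u v. h (\<Delta> u v)) \<in> cocycles2 L s2 U'"
proof -
  have vs: "vector_space (vscale L)" "vector_space s2"
    using assms(1,3)
    by (auto simp: cocycles2_def cochains2_def bilinear_into_def Vector_Spaces.linear_iff)
  have h: "h (a + b) = h a + h b" "h (s1 c a) = s2 c (h a)" for a b c
    using assms(1) by (auto simp: Vector_Spaces.linear_iff)
  have h_diff: "h (a - b) = h a - h b" for a b
    using h(1)[of "a - b" b] by simp
  have h_0: "h 0 = 0"
    using h(1)[of 0 0] by simp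
  have bil: "bilinear_into (vscale L) s1 U \<Delta>" and sym: "\<Delta> u v = \<Delta> v u"
    and d2: "d2 L \<Delta> v0 v1 v2 = 0" for u v v0 v1 v2
    using assms(3) by (auto simp: cocycles2_def cochains2_def)
  note bilD = bilinear_intoD[OF bil]
  have "bilinear_into (vscale L) s2 U' (\<lambda>u v. h (\<Delta> u v))"
    using assms(2) bilD(1) by (intro bilinear_intoI vs) (auto simp: bilD(2-5) h)
  moreover have "d2 L (\<lambda>u v. h (\<Delta> u v)) v0 v1 v2 = 0" for v0 v1 v2
  proof -
    have "d2 L (\<lambda>u v. h (\<Delta> u v)) v0 v1 v2 = h (d2 L \<Delta> v0 v1 v2)"
      by (simp add: d2_def h h_diff)
    then show ?thesis by (simp add: d2 h_0)
  qed
  ultimately show ?thesis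
    using sym by (simp add: cocycles2_def cochains2_def)
qed

text \<open>Applying \<open>h\<close> to values commutes with \<open>d1\<close> and
  \<open>d2\<close>, so \<open>h\<close> composed with \<delta> witnesses the new coboundary. It is
  needed for the passage between \<open>U\<close> and its copy \<open>U \<times> {0}\<close> inside
  the product.\<close>

lemma coh_class_map:
  assumes h: "Vector_Spaces.linear s1 s2 h" "h ` U \<subseteq> U'" and X: "\<Delta>' \<in> coh_class L s1 U \<Delta>"
  shows "(\<lambda>u v. h (\<Delta>' u v)) \<in> coh_class L s2 U' (\<lambda>u v. h (\<Delta> u v))"
proof -
  obtain \<delta> where \<delta>: "\<delta> \<in> cochains1 L s1 U" "\<forall>u v. \<Delta>' u v - \<Delta> u v = d1 L s1 \<delta> u v"
    using X unfolding mem_coh_class_iff by blast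
  have hD: "h (a + b) = h a + h b" "h (s1 c a) = s2 c (h a)" for a b c
    using h(1) by (auto simp: Vector_Spaces.linear_iff)
  have h_diff: "h (a - b) = h a - h b" for a b
    using hD(1)[of "a - b" b] by simp
  have "(\<lambda>x. h (\<delta> x)) \<in> cochains1 L s2 U'"
    using \<delta>(1) h by (auto simp: cochains1_def Vector_Spaces.linear_iff image_subset_iff)
  moreover have "h (\<Delta>' u v) - h (\<Delta> u v) = d1 L s2 (\<lambda>x. h (\<delta> x)) u v" for u v
    unfolding h_diff[symmetric] \<delta>(2)[rule_format] by (simp add: d1_def hD)
  ultimately show ?thesis
    using X cocycles2_map[OF h] unfolding mem_coh_class_iff by blast
qed

section \<open>Symmetric enhanced Leibniz algebras\<close>

lemma ELAD:
  assumes "ELA A"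
  shows "leibniz_algebra A" "vector_space (wscale A)" "module.subspace (wscale A) (wcarrier A)"
    and "linear_on (wscale A) (vscale A) (wcarrier A) UNIV (anchor A)"
    and "bilinear_into (vscale A) (wscale A) (wcarrier A) (eprod A)"
    and "\<forall>w\<in>wcarrier A. \<forall>v. bracket A (anchor A w) v = 0"
    and "\<forall>w\<in>wcarrier A. eprod A (anchor A w) (anchor A w) = 0"
    and "\<forall>u v. eprod_sym A u (bracket A v v) = eprod_sym A v (bracket A u v)"
    and "\<forall>v. bracket A v v = anchor A (eprod A v v)"
  by (insert assms, unfold ELA_def, elim conjE, assumption)+

lemma sELAD:
  assumes "sELA E"
  shows "ELA E" "\<forall>u v. eprod E u v = eprod E v u"
  by (insert assms, unfold sELA_def, elim conjE, assumption)+

locale symmetric_ELA =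
  fixes E :: "('k::field, 'v::ab_group_add, 'w::ab_group_add) enhanced"
  assumes sELA: "sELA E" and two_neq_zero: "(2::'k) \<noteq> 0"
begin

abbreviation "br \<equiv> bracket E"
text \<open>Twice the symmetric part of the bracket, the argument at which \<open>Delta_of\<close>
  evaluates the section.\<close>

abbreviation "jor u v \<equiv> br u v + br v u"
abbreviation "I \<equiv> im_anchor E"
abbreviation "K \<equiv> ker_anchor E"

lemmas ELA = ELAD[OF sELAD(1)[OF sELA]]
lemmas leibniz = ELA(1)

sublocale V: vector_space "vscale E"
  by (rule leibniz_algebraD(1)[OF leibniz])

sublocale W: vector_space "wscale E"
  by (rule ELA(2))

lemmas br = bilinear_intoD[OF leibniz_algebraD(2)[OF leibniz]]
lemmas leibniz_id = leibniz_algebraD(3)[OF leibniz, rule_format]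

lemmas W_sub = ELA(3)
  and anchor = ELA(4)
  and eprod_bilinear = ELA(5)
  and eprod_commute = sELAD(2)[OF sELA, rule_format]
  and bracket_diag = ELA(9)[rule_format]

lemmas anchor_add = linear_onD(2)[OF anchor]
  and anchor_scale = linear_onD(3)[OF anchor]
  and anchor_zero = linear_on_zero[OF anchor W.subspace_0[OF W_sub]]
  and anchor_diff = linear_on_diff[OF anchor W.vector_space_axioms W_sub]

lemmas eprod = bilinear_intoD[OF eprod_bilinear]

text \<open>Turns the axiom on \<open>u\<close> and \<open>[v,v]\<close>, stated for the symmetrized
  product, into the identity \<open>eprod_square\<close> for the product itself.\<close>

lemma eprod_sym_eq: "eprod_sym E u v = eprod E u v"
  using W.scale_half_double[OF two_neq_zero] by (simp add: eprod_sym_def eprod_commute[of v u])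

lemmas eprod_square = ELA(8)[unfolded eprod_sym_eq, rule_format]

section \<open>Image and kernel of the anchor; the polarized axioms\<close>

lemma anchorI: "w \<in> wcarrier E \<Longrightarrow> anchor E w \<in> I"
  by (simp add: im_anchor_def)

lemma I_sub: "V.subspace I"
proof (rule V.subspaceI)
  show "0 \<in> I"
    using anchorI[OF W.subspace_0[OF W_sub]] by (simp add: anchor_zero)
next
  fix x y assume "x \<in> I" "y \<in> I"
  then show "x + y \<in> I"
    unfolding im_anchor_def by (auto simp: W.subspace_add[OF W_sub] simp flip: anchor_add)
next
  fix c x assume "x \<in> I"
  then show "vscale E c x \<in> I"
    unfolding im_anchor_def by (auto simp: W.subspace_scale[OF W_sub] simp flip: anchor_scale)
qed

lemma K_sub: "W.subspace K"
proof (rule W.subspaceI)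
  show "0 \<in> K"
    by (simp add: ker_anchor_def anchor_zero W.subspace_0[OF W_sub])
qed (auto simp: ker_anchor_def anchor_add anchor_scale
    W.subspace_add[OF W_sub] W.subspace_scale[OF W_sub])

text \<open>Polarization of the axiom that \<open>[v,v]\<close> is the anchor of
  \<open>v \<circ> v\<close>, followed by halving.\<close>

lemma anchor_eprod: "anchor E (eprod E u v) = vscale E (1/2) (jor u v)"
proof -
  have "br (u + v) (u + v) = br u u + jor u v + br v v"
    by (simp add: br algebra_simps)
  moreover have "br (u + v) (u + v)
      = anchor E (eprod E u u) + anchor E (eprod E u v + eprod E u v) + anchor E (eprod E v v)"
    unfolding bracket_diag[of "u + v"]
    by (simp add: eprod anchor_add W.subspace_add[OF W_sub] eprod_commute[of v u] algebra_simps)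
  ultimately have "jor u v = anchor E (eprod E u v) + anchor E (eprod E u v)"
    by (simp add: bracket_diag[of u] bracket_diag[of v] anchor_add eprod)
  then show ?thesis
    by (simp add: V.scale_half_double[OF two_neq_zero])
qed

text \<open>A section is controlled only on \<open>im t\<close>, so each evaluation of one in
  \<open>Delta_of\<close> relies on this membership. Half of \<open>jor u v\<close> is an anchor,
  and doubling stays in the subspace.\<close>

lemma jor_in_I: "jor u v \<in> I"
proof -
  have "vscale E (1/2) (jor u v) \<in> I"
    by (simp add: anchorI eprod(1) flip: anchor_eprod)
  from V.subspace_add[OF I_sub this this] show ?thesis
    using V.scale_half_double[OF two_neq_zero, of "jor u v"]
    by (simp only: V.scale_right_distrib)
qed

lemma bracket_I_left: "x \<in> I \<Longrightarrow> br x y = 0"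
  using ELA(6) by (auto simp: im_anchor_def)

text \<open>The opposite bracket \<open>br x v\<close> vanishes, so \<open>br v x\<close> coincides
  with \<open>jor v x\<close>.\<close>

lemma bracket_I_right: "x \<in> I \<Longrightarrow> br v x \<in> I"
  using jor_in_I[of v x] by (simp add: bracket_I_left)

lemma leibniz_couple: "leibniz_couple E I"
proof -
  have "br x x \<in> I" for x
    by (simp add: bracket_diag anchorI eprod)
  then have "Sq E \<subseteq> I"
    unfolding Sq_def by (intro V.span_minimal I_sub) blast
  then show ?thesis
    using leibniz I_sub bracket_I_left bracket_I_right
    by (auto simp: leibniz_couple_def left_center_def)
qed

text \<open>Polarization of the axiom that \<open>t w \<circ> t w\<close> vanishes: symmetry of the
  product gives twice the claim.\<close>

lemma eprod_I:
  assumes "m \<in> I" "n \<in> I"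
  shows "eprod E m n = 0"
proof -
  have diag: "eprod E x x = 0" if "x \<in> I" for x
    using ELA(7) that by (auto simp: im_anchor_def)
  have "eprod E m n + eprod E m n = 0"
    using diag[OF V.subspace_add[OF I_sub assms]] diag[OF assms(1)] diag[OF assms(2)]
    by (simp add: eprod eprod_commute[of n m])
  then show ?thesis
    using W.scale_half_double[OF two_neq_zero, of "eprod E m n"] by simp
qed

text \<open>The cocycle identity is \<open>eprod_square\<close> polarized in its repeated variable.
  The product takes values in \<open>W\<close>, not only in \<open>ker t\<close>, yet the formula of
  \<open>d2\<close> already kills it.\<close>

lemma d2_eprod: "d2 E (eprod E) v0 v1 v2 = 0"
proof -
  have "eprod E v0 (br (v1 + v2) (v1 + v2)) = eprod E (v1 + v2) (br v0 (v1 + v2))"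
    by (rule eprod_square)
  then have "eprod E v0 (br v1 v2) + eprod E v0 (br v2 v1) = eprod E v1 (br v0 v2) + eprod E v2 (br v0 v1)"
    using eprod_square[of v0 v1] eprod_square[of v0 v2] by (simp add: br eprod algebra_simps)
  then show ?thesis
    by (simp add: d2_def eprod_commute[of "br v0 v1" v2] algebra_simps)
qed

text \<open>Left multiplication is a derivation of the bracket by the Leibniz identity, hence also
  of its symmetrization.\<close>

lemma jor_derivation: "br v0 (jor v1 v2) = jor (br v0 v1) v2 + jor v1 (br v0 v2)"
  using leibniz_id[of v0 v1 v2] leibniz_id[of v0 v2 v1] by (simp add: br algebra_simps)

section \<open>Sections of the anchor and the cocycles they define\<close>

lemma sectionsD:
  assumes "\<sigma> \<in> sections E"
  shows "linear_on (vscale E) (wscale E) I (wcarrier E) \<sigma>"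
    and "x \<in> I \<Longrightarrow> anchor E (\<sigma> x) = x" and "x \<in> I \<Longrightarrow> \<sigma> x \<in> wcarrier E"
    and "x \<in> I \<Longrightarrow> y \<in> I \<Longrightarrow> \<sigma> (x + y) = \<sigma> x + \<sigma> y"
    and "x \<in> I \<Longrightarrow> \<sigma> (vscale E c x) = wscale E c (\<sigma> x)"
    and "\<sigma> 0 = 0"
proof -
  show *: "linear_on (vscale E) (wscale E) I (wcarrier E) \<sigma>"
    using assms by (simp add: sections_def)
  show "x \<in> I \<Longrightarrow> anchor E (\<sigma> x) = x"
    using assms by (simp add: sections_def)
  show "x \<in> I \<Longrightarrow> \<sigma> x \<in> wcarrier E"
    "x \<in> I \<Longrightarrow> y \<in> I \<Longrightarrow> \<sigma> (x + y) = \<sigma> x + \<sigma> y"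
    "x \<in> I \<Longrightarrow> \<sigma> (vscale E c x) = wscale E c (\<sigma> x)"
    "\<sigma> 0 = 0"
    using linear_onD[OF *] linear_on_zero[OF * V.subspace_0[OF I_sub]] by blast+
qed

lemma sections_nonempty: "sections E \<noteq> {}"
  using linear_on_right_inverse[OF W.vector_space_axioms V.vector_space_axioms W_sub anchor]
  unfolding sections_def im_anchor_def by blast

text \<open>Both terms of \<open>Delta_of\<close> have the same anchor, half of
  \<open>jor u v\<close>.\<close>

lemma Delta_of_in_K:
  assumes "\<sigma> \<in> sections E"
  shows "Delta_of E \<sigma> u v \<in> K"
  using sectionsD[OF assms] jor_in_I[of u v]
  by (simp add: Delta_of_def ker_anchor_def anchor_diff anchor_scale eprod anchor_eprod
      W.subspace_diff[OF W_sub] W.subspace_scale[OF W_sub])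

lemma Delta_of_cochain:
  assumes "\<sigma> \<in> sections E"
  shows "Delta_of E \<sigma> \<in> cochains2 E (wscale E) K"
proof -
  have jor_add: "jor (u + u') v = jor u v + jor u' v" for u u' v
    by (simp add: br algebra_simps)
  have jor_scale: "jor (vscale E c u) v = vscale E c (jor u v)" for c u v
    by (simp add: br V.scale_right_distrib)
  have add: "Delta_of E \<sigma> (u + u') v = Delta_of E \<sigma> u v + Delta_of E \<sigma> u' v" for u u' v
    unfolding Delta_of_def jor_add
    by (simp add: sectionsD[OF assms] jor_in_I eprod W.scale_right_distrib)
  have scale: "Delta_of E \<sigma> (vscale E c u) v = wscale E c (Delta_of E \<sigma> u v)" for c u v
    unfolding Delta_of_def jor_scale
    by (simp add: sectionsD[OF assms] jor_in_I eprod W.scale_right_diff_distrib mult.commute)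
  have sym: "Delta_of E \<sigma> u v = Delta_of E \<sigma> v u" for u v
    by (simp add: Delta_of_def eprod_commute[of u v] add.commute)
  \<comment> \<open>Symmetry reduces linearity in the second argument to the first.\<close>
  have add': "Delta_of E \<sigma> u (v + v') = Delta_of E \<sigma> u v + Delta_of E \<sigma> u v'" for u v v'
    using add[of v v' u] by (simp only: sym[of u])
  have scale': "Delta_of E \<sigma> u (vscale E c v) = wscale E c (Delta_of E \<sigma> u v)" for c u v
    using scale[of c v u] by (simp only: sym[of u])
  have "bilinear_into (vscale E) (wscale E) K (Delta_of E \<sigma>)"
    by (rule bilinear_intoI)
      (fact V.vector_space_axioms W.vector_space_axioms Delta_of_in_K[OF assms] add add' scale scale')+
  then show ?thesis
    using sym by (simp add: cochains2_def)
qed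

text \<open>The product satisfies the cocycle identity by \<open>d2_eprod\<close>, so it remains to
  treat the \<sigma>-terms, where the identity already holds for \<open>jor\<close> before \<sigma>
  is applied.\<close>

lemma Delta_of_cocycle:
  assumes "\<sigma> \<in> sections E"
  shows "Delta_of E \<sigma> \<in> cocycles2 E (wscale E) K"
proof -
  note \<sigma> = sectionsD[OF assms]
  have "d2 E (Delta_of E \<sigma>) v0 v1 v2 = 0" for v0 v1 v2
  proof -
    let ?h = "wscale E (1/2)"
    have "\<sigma> (jor (br v0 v1) v2) + \<sigma> (jor v1 (br v0 v2)) = \<sigma> (br v0 (jor v1 v2))"
      by (simp only: jor_derivation \<sigma> jor_in_I)
    \<comment> \<open>The two brackets added on the right sum to \<open>br (jor v1 v2) v0\<close>,
      which vanishes because \<open>jor v1 v2\<close> lies in \<open>im t\<close>.\<close>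
    also have "br v0 (jor v1 v2) = jor v0 (br v1 v2) + jor v0 (br v2 v1)"
      using bracket_I_left[OF jor_in_I, of v1 v2 v0] by (simp add: br algebra_simps)
    also have "\<sigma> \<dots> = \<sigma> (jor v0 (br v1 v2)) + \<sigma> (jor v0 (br v2 v1))"
      by (simp only: \<sigma> jor_in_I)
    finally have "?h (\<sigma> (jor (br v0 v1) v2)) + ?h (\<sigma> (jor v1 (br v0 v2)))
        = ?h (\<sigma> (jor v0 (br v1 v2))) + ?h (\<sigma> (jor v0 (br v2 v1)))"
      by (simp only: flip: W.scale_right_distrib)
    then show ?thesis
      using d2_eprod[of v0 v1 v2] by (simp add: d2_def Delta_of_def algebra_simps)
  qed
  then show ?thesis
    using Delta_of_cochain[OF assms] by (simp add: cocycles2_def)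
qed

lemma Delta_of_I:
  assumes "\<sigma> \<in> sections E" "m \<in> I" "n \<in> I"
  shows "Delta_of E \<sigma> m n = 0"
  using assms by (simp add: Delta_of_def eprod_I bracket_I_left sectionsD)

text \<open>The values of \<delta> lie in \<open>ker t\<close>, so subtracting them does not change
  the anchor.\<close>

lemma section_diff_cochain:
  assumes "\<sigma> \<in> sections E" "\<delta> \<in> cochains1 E (wscale E) K"
  shows "(\<lambda>x. \<sigma> x - \<delta> x) \<in> sections E"
proof -
  have \<delta>: "\<delta> x \<in> wcarrier E" "anchor E (\<delta> x) = 0" "\<delta> (x + y) = \<delta> x + \<delta> y"
      "\<delta> (vscale E c x) = wscale E c (\<delta> x)" for x y c
    using assms(2) unfolding cochains1_def ker_anchor_def Vector_Spaces.linear_iff image_subset_iff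
    by auto
  have "linear_on (vscale E) (wscale E) I (wcarrier E) (\<lambda>x. \<sigma> x - \<delta> x)"
    unfolding linear_on_def
    by (auto simp: \<delta> sectionsD[OF assms(1)] W.subspace_diff[OF W_sub] W.scale_right_diff_distrib)
  moreover have "\<forall>x\<in>I. anchor E (\<sigma> x - \<delta> x) = x"
    by (simp add: \<delta> sectionsD[OF assms(1)] anchor_diff)
  ultimately show ?thesis
    by (simp add: sections_def)
qed

text \<open>The products cancel, and only the value of \<delta> at \<open>jor u v\<close>, a point
  of \<open>im t\<close>, remains. The order of the difference \<sigma> - \<sigma>' reflects the
  minus sign of the section in \<open>Delta_of\<close>.\<close>

lemma Delta_of_section_diff:
  assumes "\<sigma> \<in> sections E" "\<sigma>' \<in> sections E" "Vector_Spaces.linear (vscale E) (wscale E) \<delta>"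
    and "\<And>x. x \<in> I \<Longrightarrow> \<delta> x = \<sigma> x - \<sigma>' x"
  shows "Delta_of E \<sigma>' u v - Delta_of E \<sigma> u v = d1 E (wscale E) \<delta> u v"
proof -
  have "Delta_of E \<sigma>' u v - Delta_of E \<sigma> u v = wscale E (1/2) (\<delta> (jor u v))"
    by (simp add: Delta_of_def assms(4)[OF jor_in_I] W.scale_right_diff_distrib)
  also have "\<dots> = d1 E (wscale E) \<delta> u v"
    using assms(3) by (simp add: d1_def Vector_Spaces.linear_iff W.scale_right_distrib)
  finally show ?thesis .
qed

lemma coh_class_Delta_of:
  assumes "\<sigma> \<in> sections E"
  shows "coh_class E (wscale E) K (Delta_of E \<sigma>) = Delta_of E ` sections E"
proof (intro set_eqI iffI)
  fix \<Delta> assume "\<Delta> \<in> coh_class E (wscale E) K (Delta_of E \<sigma>)"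
  then obtain \<delta> where \<delta>: "\<delta> \<in> cochains1 E (wscale E) K"
      "\<And>u v. \<Delta> u v - Delta_of E \<sigma> u v = d1 E (wscale E) \<delta> u v"
    unfolding mem_coh_class_iff by blast
  note \<sigma>' = section_diff_cochain[OF assms \<delta>(1)]
  have "Vector_Spaces.linear (vscale E) (wscale E) \<delta>"
    using \<delta>(1) by (simp add: cochains1_def)
  \<comment> \<open>The section shifted by \<delta> differs from \<sigma> by the same coboundary as
    \<Delta> does from \<open>Delta_of E \<sigma>\<close>, so it realizes \<Delta>.\<close>
  then have "Delta_of E (\<lambda>x. \<sigma> x - \<delta> x) u v - Delta_of E \<sigma> u v = \<Delta> u v - Delta_of E \<sigma> u v" for u v
    unfolding \<delta>(2) by (intro Delta_of_section_diff[OF assms \<sigma>']) simp_all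
  then have "Delta_of E (\<lambda>x. \<sigma> x - \<delta> x) = \<Delta>"
    by (simp add: fun_eq_iff)
  then show "\<Delta> \<in> Delta_of E ` sections E"
    using \<sigma>' by blast
next
  fix \<Delta> assume "\<Delta> \<in> Delta_of E ` sections E"
  then obtain \<sigma>' where \<sigma>': "\<sigma>' \<in> sections E" "\<Delta> = Delta_of E \<sigma>'"
    by blast
  have "linear_on (vscale E) (wscale E) I K (\<lambda>x. \<sigma> x - \<sigma>' x)"
    unfolding linear_on_def
    by (auto simp: sectionsD[OF assms] sectionsD[OF \<sigma>'(1)] ker_anchor_def anchor_diff
        W.subspace_diff[OF W_sub] W.scale_right_diff_distrib)
  \<comment> \<open>Off \<open>im t\<close> the functions \<sigma> and \<sigma>' are arbitrary, so
    their difference is not itself a cochain and is replaced by a linear extension of its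
    restriction.\<close>
  then obtain \<delta> where \<delta>: "Vector_Spaces.linear (vscale E) (wscale E) \<delta>" "range \<delta> \<subseteq> K"
      "\<forall>x\<in>I. \<delta> x = \<sigma> x - \<sigma>' x"
    using linear_on_extend[OF V.vector_space_axioms W.vector_space_axioms I_sub K_sub] by blast
  have "\<delta> \<in> cochains1 E (wscale E) K"
    using \<delta> by (simp add: cochains1_def)
  moreover have "\<forall>u v. \<Delta> u v - Delta_of E \<sigma> u v = d1 E (wscale E) \<delta> u v"
    using Delta_of_section_diff[OF assms \<sigma>'(1) \<delta>(1)] \<delta>(3) \<sigma>'(2) by blast
  ultimately show "\<Delta> \<in> coh_class E (wscale E) K (Delta_of E \<sigma>)"
    unfolding mem_coh_class_iff using \<sigma>' Delta_of_cocycle assms by blast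
qed

text \<open>The set on the right mentions no particular section, and sections exist; hence the
  definite description in \<open>data_of\<close> has exactly one solution.\<close>

lemma class2_data_of: "class2 (data_of E) = Delta_of E ` sections E"
proof -
  have "(THE c. \<exists>\<sigma>\<in>sections E. c = coh_class E (wscale E) K (Delta_of E \<sigma>))
      = Delta_of E ` sections E"
    using sections_nonempty by (intro the_equality) (auto simp: coh_class_Delta_of)
  then show ?thesis
    by (simp add: data_of_def)
qed

lemma data_of_simps:
  "vscale (data_of E) = vscale E" "bracket (data_of E) = bracket E" "ideal (data_of E) = I"
  "uscale (data_of E) = wscale E" "ucarrier (data_of E) = K"
  by (simp_all add: data_of_def)

lemma classifying_data_data_of: "classifying_data (data_of E)"
proof -
  obtain \<sigma> where \<sigma>: "\<sigma> \<in> sections E"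
    using sections_nonempty by blast
  have "class2 (data_of E) = cohomologous E (wscale E) K `` {Delta_of E \<sigma>}"
    by (simp add: class2_data_of coh_class_Delta_of[OF \<sigma>] flip: coh_class_def)
  then have "class2 (data_of E) \<in> H2 E (wscale E) K"
    using Delta_of_cocycle[OF \<sigma>] by (simp add: H2_def quotientI)
  moreover have "H2 (data_of E) (wscale E) K = H2 E (wscale E) K"
    by (intro H2_cong) (simp_all add: data_of_simps)
  moreover have "leibniz_couple (data_of E) I"
    using leibniz_couple leibniz_couple_cong[of "data_of E" E I] by (simp add: data_of_simps)
  ultimately show ?thesis
    unfolding classifying_data_def data_of_simps
    using W.vector_space_axioms K_sub Delta_of_I by (auto simp: class2_data_of)
qed

end

section \<open>Isomorphisms\<close>

lemma linear_isoD:
  assumes "linear_iso_on s1 s2 UNIV UNIV \<psi>"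
  shows "bij \<psi>" "\<psi> (x + y) = \<psi> x + \<psi> y" "\<psi> (s1 c x) = s2 c (\<psi> x)"
    "inv \<psi> (\<psi> x) = x" "\<psi> (inv \<psi> z) = z"
proof -
  have lin: "linear_on s1 s2 UNIV UNIV \<psi>" and bij: "bij \<psi>"
    using assms by (simp_all add: linear_iso_on_def)
  show "bij \<psi>" by (fact bij)
  show "\<psi> (x + y) = \<psi> x + \<psi> y" "\<psi> (s1 c x) = s2 c (\<psi> x)"
    using linear_onD(2,3)[OF lin] by simp_all
  show "inv \<psi> (\<psi> x) = x" "\<psi> (inv \<psi> z) = z"
    using bij by (simp_all add: bij_is_inj bij_is_surj surj_f_inv_f)
qed

text \<open>The map on coefficients is the restriction of \<phi> to \<open>ker t\<close>. As each
  class is the set of all \<open>Delta_of\<close> over sections, it suffices to move sections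
  forward and back along \<phi> and \<psi>.\<close>

lemma sELA_iso_imp_data_iso:
  fixes E :: "('k::field, 'v::ab_group_add, 'w::ab_group_add) enhanced"
    and E' :: "('k, 'v'::ab_group_add, 'w'::ab_group_add) enhanced"
  assumes "symmetric_ELA E" "symmetric_ELA E'" "sELA_iso E E'"
  shows "data_iso (data_of E) (data_of E')"
proof -
  interpret E: symmetric_ELA E by fact
  interpret E': symmetric_ELA E' by fact
  obtain \<phi> \<psi> where \<phi>: "linear_iso_on (wscale E) (wscale E') (wcarrier E) (wcarrier E') \<phi>"
    and \<psi>: "linear_iso_on (vscale E) (vscale E') UNIV UNIV \<psi>"
    and anchor: "\<forall>w\<in>wcarrier E. \<psi> (anchor E w) = anchor E' (\<phi> w)"
    and br: "\<forall>x y. \<psi> (bracket E x y) = bracket E' (\<psi> x) (\<psi> y)"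
    and eprod: "\<forall>x y. eprod E' (\<psi> x) (\<psi> y) = \<phi> (eprod E x y)"
    using assms(3) unfolding sELA_iso_def by (elim exE conjE)
  have \<phi>_lin: "linear_on (wscale E) (wscale E') (wcarrier E) (wcarrier E') \<phi>"
    and \<phi>_bij: "bij_betw \<phi> (wcarrier E) (wcarrier E')"
    using \<phi> by (simp_all add: linear_iso_on_def)
  note \<psi>D = linear_isoD[OF \<psi>]
  note \<phi>D = linear_onD[OF \<phi>_lin]
  have \<phi>_im: "\<phi> ` wcarrier E = wcarrier E'"
    using \<phi>_bij by (simp add: bij_betw_def)
  have ideal: "\<psi> ` E.I = E'.I"
    unfolding im_anchor_def \<phi>_im[symmetric] image_image using anchor by (intro image_cong) auto
  have inv_I: "inv \<psi> x \<in> E.I" if "x \<in> E'.I" for x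
    using that \<psi>D(4) unfolding ideal[symmetric] by auto
  have \<psi>_I: "\<psi> x \<in> E'.I" if "x \<in> E.I" for x
    using that ideal by auto
  have inv_jor: "inv \<psi> (E'.jor x y) = E.jor (inv \<psi> x) (inv \<psi> y)" for x y
  proof -
    have "E'.jor x y = \<psi> (E.jor (inv \<psi> x) (inv \<psi> y))"
      by (simp add: \<psi>D br)
    then show ?thesis by (simp only: \<psi>D(4,5))
  qed
  have \<psi>_zero: "\<psi> x = 0 \<longleftrightarrow> x = 0" for x
    using \<psi>D(2)[of 0 0] \<psi>D(4)[of x] \<psi>D(4)[of 0] by auto
  have "\<phi> ` E.K = E'.K"
  proof
    show "\<phi> ` E.K \<subseteq> E'.K"
      using anchor \<phi>D(1) \<psi>_zero unfolding ker_anchor_def by force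
    show "E'.K \<subseteq> \<phi> ` E.K"
    proof
      fix w assume w: "w \<in> E'.K"
      then obtain k where k: "k \<in> wcarrier E" "w = \<phi> k"
        unfolding ker_anchor_def \<phi>_im[symmetric] by auto
      then have "\<psi> (anchor E k) = 0"
        using w anchor by (simp add: ker_anchor_def)
      then show "w \<in> \<phi> ` E.K"
        using k \<psi>_zero by (simp add: ker_anchor_def)
    qed
  qed
  then have \<phi>_K: "linear_iso_on (wscale E) (wscale E') E.K E'.K \<phi>"
    using \<phi>_lin bij_betw_imp_inj_on[OF \<phi>_bij] inj_on_subset[of \<phi> "wcarrier E" E.K]
    by (auto simp: linear_iso_on_def linear_on_def bij_betw_def ker_anchor_def)
  \<comment> \<open>Agreement of \<sigma>' with the transported section is asked only on
    \<open>im t'\<close>, the set where \<open>Delta_of\<close> evaluates it and the only place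
    where \<open>pull\<close> provides it.\<close>
  have transport: "Delta_of E' \<sigma>' x y = \<phi> (Delta_of E \<sigma> (inv \<psi> x) (inv \<psi> y))"
    if \<sigma>: "\<sigma> \<in> sections E" and \<sigma>': "\<And>x. x \<in> E'.I \<Longrightarrow> \<sigma>' x = \<phi> (\<sigma> (inv \<psi> x))" for \<sigma> \<sigma>' x y
  proof -
    note \<sigma>D = E.sectionsD[OF \<sigma>]
    have "eprod E' x y = \<phi> (eprod E (inv \<psi> x) (inv \<psi> y))"
      using eprod[rule_format, of "inv \<psi> x" "inv \<psi> y"] by (simp only: \<psi>D(4,5))
    then show ?thesis
      unfolding Delta_of_def
      by (simp add: \<sigma>' E'.jor_in_I inv_jor \<phi>D \<sigma>D E.jor_in_I E.eprod E.W.subspace_scale[OF E.W_sub]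
          linear_on_diff[OF \<phi>_lin E.W.vector_space_axioms E.W_sub])
  qed
  have push: "(\<lambda>x. \<phi> (\<sigma> (inv \<psi> x))) \<in> sections E'" if \<sigma>: "\<sigma> \<in> sections E" for \<sigma>
  proof -
    note \<sigma>D = E.sectionsD[OF \<sigma>]
    have inv: "linear_on (vscale E') (vscale E) E'.I E.I (inv \<psi>)"
      using linear_iso_on_inv[OF \<psi> E.V.vector_space_axioms] inv_I
      by (auto simp: linear_iso_on_def linear_on_def)
    have "anchor E' (\<phi> (\<sigma> (inv \<psi> x))) = x" if "x \<in> E'.I" for x
      using anchor[rule_format, of "\<sigma> (inv \<psi> x)"] \<sigma>D(2,3)[OF inv_I[OF that]] by (simp add: \<psi>D)
    then show ?thesis
      using linear_on_comp[OF linear_on_comp[OF inv \<sigma>D(1)] \<phi>_lin] by (simp add: sections_def)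
  qed
  have pull: "\<exists>\<sigma>\<in>sections E. \<forall>x\<in>E'.I. \<sigma>' x = \<phi> (\<sigma> (inv \<psi> x))" if \<sigma>': "\<sigma>' \<in> sections E'" for \<sigma>'
  proof -
    note \<sigma>D = E'.sectionsD[OF \<sigma>']
    \<comment> \<open>The section sought is \<sigma>' conjugated back: first \<psi>, then \<sigma>',
      then the inverse of \<phi> on \<open>W'\<close>. Since \<open>?g\<close> inverts \<phi> only
      on \<open>W'\<close>, the final equality is confined to \<open>im t'\<close>.\<close>
    let ?g = "inv_into (wcarrier E) \<phi>"
    have g: "linear_on (wscale E') (wscale E) (wcarrier E') (wcarrier E) ?g"
      using linear_iso_on_inv[OF \<phi> E.W.vector_space_axioms E.W_sub] by (simp add: linear_iso_on_def)
    have \<phi>g: "\<phi> (?g w) = w" if "w \<in> wcarrier E'" for w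
      using that by (simp add: f_inv_into_f \<phi>_im)
    have \<psi>_lin: "linear_on (vscale E) (vscale E') E.I E'.I \<psi>"
      using \<psi>_I by (auto simp: linear_on_def \<psi>D)
    have "anchor E (?g (\<sigma>' (\<psi> x))) = x" if "x \<in> E.I" for x
    proof -
      have mem: "\<sigma>' (\<psi> x) \<in> wcarrier E'"
        by (rule \<sigma>D(3)[OF \<psi>_I[OF that]])
      have "\<psi> (anchor E (?g (\<sigma>' (\<psi> x)))) = \<psi> x"
        using anchor[rule_format, OF linear_onD(1)[OF g mem]] \<sigma>D(2)[OF \<psi>_I[OF that]]
        by (simp add: \<phi>g mem)
      then have "inv \<psi> (\<psi> (anchor E (?g (\<sigma>' (\<psi> x))))) = inv \<psi> (\<psi> x)"
        by (rule arg_cong)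
      then show ?thesis by (simp only: \<psi>D(4,5))
    qed
    then have "(\<lambda>x. ?g (\<sigma>' (\<psi> x))) \<in> sections E"
      using linear_on_comp[OF linear_on_comp[OF \<psi>_lin \<sigma>D(1)] g] by (simp add: sections_def)
    moreover have "\<forall>x\<in>E'.I. \<sigma>' x = \<phi> (?g (\<sigma>' (\<psi> (inv \<psi> x))))"
      using \<sigma>D(3) by (simp add: \<psi>D \<phi>g)
    ultimately show ?thesis
      by (intro bexI[of _ "\<lambda>x. ?g (\<sigma>' (\<psi> x))"])
  qed
  have "(\<lambda>\<Delta> x y. \<phi> (\<Delta> (inv \<psi> x) (inv \<psi> y))) ` class2 (data_of E) = class2 (data_of E')"
    (is "?T ` _ = _")
  proof -
    have "?T (Delta_of E \<sigma>) \<in> Delta_of E' ` sections E'" if "\<sigma> \<in> sections E" for \<sigma>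
      using transport[OF that refl] push[OF that] by (intro image_eqI) (auto simp: fun_eq_iff)
    moreover have "Delta_of E' \<sigma>' \<in> ?T ` Delta_of E ` sections E" if \<sigma>': "\<sigma>' \<in> sections E'" for \<sigma>'
    proof -
      obtain \<sigma> where "\<sigma> \<in> sections E" "\<forall>x\<in>E'.I. \<sigma>' x = \<phi> (\<sigma> (inv \<psi> x))"
        using pull[OF \<sigma>'] by (elim bexE)
      then have "Delta_of E' \<sigma>' = ?T (Delta_of E \<sigma>)"
        using transport[of \<sigma> \<sigma>'] by (intro ext) simp
      then show ?thesis
        using \<open>\<sigma> \<in> sections E\<close> by simp
    qed
    ultimately show ?thesis
      unfolding E.class2_data_of E'.class2_data_of by auto
  qed
  then show ?thesis
    unfolding data_iso_def E.data_of_simps E'.data_of_simps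
    using \<psi> br ideal \<phi>_K by (intro exI[of _ \<psi>] exI[of _ \<phi>] conjI)
qed

lemma data_iso_imp_sELA_iso:
  fixes E :: "('k::field, 'v::ab_group_add, 'w::ab_group_add) enhanced"
    and E' :: "('k, 'v'::ab_group_add, 'w'::ab_group_add) enhanced"
  assumes "symmetric_ELA E" "symmetric_ELA E'" "data_iso (data_of E) (data_of E')"
  shows "sELA_iso E E'"
proof -
  interpret E: symmetric_ELA E by fact
  interpret E': symmetric_ELA E' by fact
  obtain \<psi> \<chi> where \<psi>: "linear_iso_on (vscale E) (vscale E') UNIV UNIV \<psi>"
    and br: "\<forall>x y. \<psi> (bracket E x y) = bracket E' (\<psi> x) (\<psi> y)"
    and ideal: "\<psi> ` E.I = E'.I"
    and \<chi>: "linear_iso_on (wscale E) (wscale E') E.K E'.K \<chi>"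
    and cls: "(\<lambda>\<Delta> x y. \<chi> (\<Delta> (inv \<psi> x) (inv \<psi> y))) ` class2 (data_of E) = class2 (data_of E')"
    using assms(3) unfolding data_iso_def E.data_of_simps E'.data_of_simps by (elim exE conjE)
  have \<chi>_lin: "linear_on (wscale E) (wscale E') E.K E'.K \<chi>" and \<chi>_bij: "bij_betw \<chi> E.K E'.K"
    using \<chi> by (simp_all add: linear_iso_on_def)
  note \<psi>D = linear_isoD[OF \<psi>]
  note \<chi>D = linear_onD[OF \<chi>_lin]
  obtain \<sigma> where \<sigma>: "\<sigma> \<in> sections E"
    using E.sections_nonempty by auto
  \<comment> \<open>The transported cocycle lies in the class of \<open>E'\<close>, whose members
    all come from sections; this produces a section \<sigma>' matching \<sigma> exactly, not merely
    up to a coboundary.\<close>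
  have "(\<lambda>x y. \<chi> (Delta_of E \<sigma> (inv \<psi> x) (inv \<psi> y))) \<in> Delta_of E' ` sections E'"
    using \<sigma> cls unfolding E.class2_data_of E'.class2_data_of by auto
  then obtain \<sigma>' where \<sigma>': "\<sigma>' \<in> sections E'"
    and eq: "(\<lambda>x y. \<chi> (Delta_of E \<sigma> (inv \<psi> x) (inv \<psi> y))) = Delta_of E' \<sigma>'"
    by (elim imageE)
  have Delta: "\<chi> (Delta_of E \<sigma> x y) = Delta_of E' \<sigma>' (\<psi> x) (\<psi> y)" for x y
    using fun_cong[OF fun_cong[OF eq], of "\<psi> x" "\<psi> y"] by (simp add: \<psi>D)
  note \<sigma>D = E.sectionsD[OF \<sigma>]
  note \<sigma>'D = E'.sectionsD[OF \<sigma>']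
  have \<psi>_I: "\<psi> x \<in> E'.I" if "x \<in> E.I" for x
    using that ideal by auto
  have K'D: "k \<in> wcarrier E'" "anchor E' k = 0" if "k \<in> E'.K" for k
    using that by (simp_all add: ker_anchor_def)
  \<comment> \<open>\<rho> projects \<open>W\<close> onto \<open>ker t\<close> along the image of
    \<sigma>. Accordingly \<phi> acts as \<chi> on \<open>ker t\<close> and sends \<sigma> x to
    \<sigma>' (\<psi> x).\<close>
  define \<rho> where "\<rho> w = w - \<sigma> (anchor E w)" for w
  define \<phi> where "\<phi> w = \<chi> (\<rho> w) + \<sigma>' (\<psi> (anchor E w))" for w
  have \<rho>_K: "\<rho> w \<in> E.K" if "w \<in> wcarrier E" for w
    using that by (simp add: \<rho>_def ker_anchor_def E.anchor_diff \<sigma>D E.anchorI E.W.subspace_diff[OF E.W_sub])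
  have \<rho>_add: "\<rho> (w + w') = \<rho> w + \<rho> w'" if "w \<in> wcarrier E" "w' \<in> wcarrier E" for w w'
    using that by (simp add: \<rho>_def E.anchor_add \<sigma>D E.anchorI)
  have \<rho>_scale: "\<rho> (wscale E c w) = wscale E c (\<rho> w)" if "w \<in> wcarrier E" for c w
    using that by (simp add: \<rho>_def E.anchor_scale \<sigma>D E.anchorI E.W.scale_right_diff_distrib)
  have \<phi>_mem: "\<phi> w \<in> wcarrier E'" if "w \<in> wcarrier E" for w
    using that by (simp add: \<phi>_def E'.W.subspace_add[OF E'.W_sub] K'D \<chi>D \<rho>_K \<sigma>'D \<psi>_I E.anchorI)
  have \<phi>_lin: "linear_on (wscale E) (wscale E') (wcarrier E) (wcarrier E') \<phi>"
    unfolding linear_on_def using \<phi>_mem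
    by (auto simp: \<phi>_def \<rho>_add \<rho>_scale \<rho>_K \<chi>D \<sigma>'D \<psi>_I E.anchorI E.anchor_add E.anchor_scale \<psi>D
        E'.W.scale_right_distrib)
  have anchor: "anchor E' (\<phi> w) = \<psi> (anchor E w)" if "w \<in> wcarrier E" for w
    using that by (simp add: \<phi>_def E'.anchor_add K'D \<chi>D \<rho>_K \<sigma>'D \<psi>_I E.anchorI)
  \<comment> \<open>An element is determined by its anchor and its \<rho>-component; \<psi> recovers
    the first, \<chi> the second.\<close>
  have "inj_on \<phi> (wcarrier E)"
  proof (rule inj_onI)
    fix w w' assume w: "w \<in> wcarrier E" "w' \<in> wcarrier E" and eq: "\<phi> w = \<phi> w'"
    have "\<psi> (anchor E w) = \<psi> (anchor E w')"
      using anchor[OF w(1)] anchor[OF w(2)] eq by simp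
    then have "inv \<psi> (\<psi> (anchor E w)) = inv \<psi> (\<psi> (anchor E w'))"
      by (rule arg_cong)
    then have a: "anchor E w = anchor E w'"
      by (simp only: \<psi>D(4,5))
    then have "\<chi> (\<rho> w) = \<chi> (\<rho> w')"
      using eq by (simp add: \<phi>_def)
    then have "\<rho> w = \<rho> w'"
      using inj_onD[OF bij_betw_imp_inj_on[OF \<chi>_bij]] \<rho>_K w by simp
    then show "w = w'"
      using a by (simp add: \<rho>_def)
  qed
  moreover have "w' \<in> \<phi> ` wcarrier E" if w': "w' \<in> wcarrier E'" for w'
  proof -
    have "anchor E' w' \<in> \<psi> ` E.I"
      using E'.anchorI[OF w'] ideal by simp
    then obtain x where x: "x \<in> E.I" "anchor E' w' = \<psi> x"
      by (elim imageE)
    \<comment> \<open>Splitting \<open>w'\<close> along \<sigma>' gives the preimage component by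
      component, namely \<open>k + \<sigma> x\<close>.\<close>
    have "w' - \<sigma>' (\<psi> x) \<in> E'.K"
      using w' x \<psi>_I
      by (simp add: ker_anchor_def E'.anchor_diff \<sigma>'D E'.W.subspace_diff[OF E'.W_sub])
    then have "w' - \<sigma>' (\<psi> x) \<in> \<chi> ` E.K"
      using \<chi>_bij by (simp add: bij_betw_def)
    then obtain k where k: "k \<in> E.K" "w' - \<sigma>' (\<psi> x) = \<chi> k"
      by (elim imageE)
    have kW: "k \<in> wcarrier E" "anchor E k = 0"
      using k(1) by (simp_all add: ker_anchor_def)
    have "anchor E (k + \<sigma> x) = x"
      by (simp add: E.anchor_add kW x \<sigma>D)
    then have "\<phi> (k + \<sigma> x) = w'"
      using k(2) by (simp add: \<phi>_def \<rho>_def algebra_simps)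
    moreover have "k + \<sigma> x \<in> wcarrier E"
      by (simp add: E.W.subspace_add[OF E.W_sub] kW \<sigma>D x)
    ultimately show ?thesis
      by (intro image_eqI[of _ _ "k + \<sigma> x"]) simp_all
  qed
  ultimately have "bij_betw \<phi> (wcarrier E) (wcarrier E')"
    using \<phi>_mem by (auto simp: bij_betw_def)
  then have "linear_iso_on (wscale E) (wscale E') (wcarrier E) (wcarrier E') \<phi>"
    using \<phi>_lin by (simp add: linear_iso_on_def)
  moreover have "eprod E' (\<psi> x) (\<psi> y) = \<phi> (eprod E x y)" for x y
  proof -
    \<comment> \<open>The \<open>ker t\<close>-component of a product is \<open>Delta_of\<close>,
      and its anchor is half of \<open>jor\<close>. The matching of cocycles handles the first and
      the morphism \<psi> the second.\<close>
    have "\<rho> (eprod E x y) = Delta_of E \<sigma> x y"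
      by (simp add: \<rho>_def Delta_of_def E.anchor_eprod \<sigma>D E.jor_in_I)
    moreover have "\<psi> (anchor E (eprod E x y)) = vscale E' (1/2) (E'.jor (\<psi> x) (\<psi> y))"
      by (simp add: E.anchor_eprod \<psi>D br)
    ultimately have "\<phi> (eprod E x y)
        = Delta_of E' \<sigma>' (\<psi> x) (\<psi> y) + wscale E' (1/2) (\<sigma>' (E'.jor (\<psi> x) (\<psi> y)))"
      by (simp only: \<phi>_def Delta \<sigma>'D(5)[OF E'.jor_in_I])
    then show ?thesis
      by (simp add: Delta_of_def)
  qed
  ultimately show ?thesis
    unfolding sELA_iso_def using \<psi> br anchor
    by (intro exI[of _ \<phi>] exI[of _ \<psi>] conjI) auto
qed

section \<open>From data to symmetric enhanced Leibniz algebras\<close>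

lemma classifying_dataD:
  assumes "classifying_data D"
  shows "leibniz_couple D (ideal D)" "vector_space (uscale D)"
    "module.subspace (uscale D) (ucarrier D)" "class2 D \<in> H2 D (uscale D) (ucarrier D)"
    "\<forall>\<Delta>\<in>class2 D. \<forall>m\<in>ideal D. \<forall>n\<in>ideal D. \<Delta> m n = 0"
  by (insert assms, unfold classifying_data_def, elim conjE, assumption)+

lemma classifying_data_vector_space:
  assumes "classifying_data D"
  shows "vector_space (vscale D)"
  by (rule leibniz_algebraD(1)[OF leibniz_coupleD(1)[OF classifying_dataD(1)[OF assms]]])

lemma class2_eq_coh_class:
  assumes "classifying_data D" "\<Delta> \<in> class2 D"
  shows "class2 D = coh_class D (uscale D) (ucarrier D) \<Delta>"
    and "\<Delta> \<in> cocycles2 D (uscale D) (ucarrier D)"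
  using coh_class_eq[OF classifying_data_vector_space[OF assms(1)]
      classifying_dataD(2,3,4)[OF assms(1)] assms(2)] by simp_all

lemma cocycles2_mem:
  assumes "\<Delta> \<in> cocycles2 L s U"
  shows "\<Delta> u v \<in> U"
proof -
  have "bilinear_into (vscale L) s U \<Delta>"
    using assms by (simp add: cocycles2_def cochains2_def)
  then show ?thesis
    by (rule bilinear_intoD(1))
qed

lemma data_iso_sym:
  assumes D: "classifying_data D" and iso: "data_iso D D'"
  shows "data_iso D' D"
proof -
  interpret V: vector_space "vscale D"
    by (rule classifying_data_vector_space[OF D])
  obtain \<psi> \<chi> where \<psi>: "linear_iso_on (vscale D) (vscale D') UNIV UNIV \<psi>"
    and br: "\<forall>x y. \<psi> (bracket D x y) = bracket D' (\<psi> x) (\<psi> y)"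
    and ideal: "\<psi> ` ideal D = ideal D'"
    and \<chi>: "linear_iso_on (uscale D) (uscale D') (ucarrier D) (ucarrier D') \<chi>"
    and cls: "(\<lambda>\<Delta> x y. \<chi> (\<Delta> (inv \<psi> x) (inv \<psi> y))) ` class2 D = class2 D'"
    using iso unfolding data_iso_def by (elim exE conjE)
  note \<psi>D = linear_isoD[OF \<psi>]
  let ?\<chi>' = "inv_into (ucarrier D) \<chi>"
  have inv_inv: "inv (inv \<psi>) = \<psi>"
    by (rule inv_inv_eq[OF \<psi>D(1)])
  have 1: "linear_iso_on (vscale D') (vscale D) UNIV UNIV (inv \<psi>)"
    using linear_iso_on_inv[OF \<psi> V.vector_space_axioms V.subspace_UNIV] .
  have 2: "inv \<psi> (bracket D' x y) = bracket D (inv \<psi> x) (inv \<psi> y)" for x y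
  proof -
    have "bracket D' x y = \<psi> (bracket D (inv \<psi> x) (inv \<psi> y))"
      by (simp add: br \<psi>D(5))
    then show ?thesis by (simp only: \<psi>D(4))
  qed
  have 3: "inv \<psi> ` ideal D' = ideal D"
    by (simp add: ideal[symmetric] image_image \<psi>D(4))
  have 4: "linear_iso_on (uscale D') (uscale D) (ucarrier D') (ucarrier D) ?\<chi>'"
    by (rule linear_iso_on_inv[OF \<chi> classifying_dataD(2,3)[OF D]])
  have inj: "inj_on \<chi> (ucarrier D)"
    using \<chi> by (auto simp: linear_iso_on_def bij_betw_def)
  \<comment> \<open>Cocycles of the class take values in \<open>ucarrier D\<close>, where
    \<open>inv_into\<close> does cancel \<chi>.\<close>
  have retract: "(\<lambda>x y. ?\<chi>' (\<chi> (\<Delta> (inv \<psi> (\<psi> x)) (inv \<psi> (\<psi> y))))) = \<Delta>" if "\<Delta> \<in> class2 D" for \<Delta>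
    by (simp add: \<psi>D(4) inv_into_f_f[OF inj] cocycles2_mem[OF class2_eq_coh_class(2)[OF D that]])
  have 5: "(\<lambda>\<Delta> x y. ?\<chi>' (\<Delta> (inv (inv \<psi>) x) (inv (inv \<psi>) y))) ` class2 D' = class2 D"
    by (simp add: inv_inv cls[symmetric] image_image retract cong: image_cong)
  show ?thesis
    unfolding data_iso_def using 1 2 3 4 5
    by (intro exI[of _ "inv \<psi>"] exI[of _ ?\<chi>'] conjI) simp_all
qed

lemma data_iso_trans:
  assumes "data_iso D D'" "data_iso D' D''"
  shows "data_iso D D''"
proof -
  obtain \<psi> \<chi> where \<psi>: "linear_iso_on (vscale D) (vscale D') UNIV UNIV \<psi>"
    and br: "\<forall>x y. \<psi> (bracket D x y) = bracket D' (\<psi> x) (\<psi> y)"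
    and ideal: "\<psi> ` ideal D = ideal D'"
    and \<chi>: "linear_iso_on (uscale D) (uscale D') (ucarrier D) (ucarrier D') \<chi>"
    and cls: "(\<lambda>\<Delta> x y. \<chi> (\<Delta> (inv \<psi> x) (inv \<psi> y))) ` class2 D = class2 D'"
    using assms(1) unfolding data_iso_def by (elim exE conjE)
  obtain \<psi>' \<chi>' where \<psi>': "linear_iso_on (vscale D') (vscale D'') UNIV UNIV \<psi>'"
    and br': "\<forall>x y. \<psi>' (bracket D' x y) = bracket D'' (\<psi>' x) (\<psi>' y)"
    and ideal': "\<psi>' ` ideal D' = ideal D''"
    and \<chi>': "linear_iso_on (uscale D') (uscale D'') (ucarrier D') (ucarrier D'') \<chi>'"
    and cls': "(\<lambda>\<Delta> x y. \<chi>' (\<Delta> (inv \<psi>' x) (inv \<psi>' y))) ` class2 D' = class2 D''"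
    using assms(2) unfolding data_iso_def by (elim exE conjE)
  have inv: "inv (\<lambda>x. \<psi>' (\<psi> x)) x = inv \<psi> (inv \<psi>' x)" for x
    using o_inv_distrib[OF linear_isoD(1)[OF \<psi>'] linear_isoD(1)[OF \<psi>]] by (simp add: comp_def fun_eq_iff)
  show ?thesis
    unfolding data_iso_def
    using linear_iso_on_comp[OF \<psi> \<psi>'] linear_iso_on_comp[OF \<chi> \<chi>'] br br'
    by (intro exI[of _ "\<lambda>x. \<psi>' (\<psi> x)"] exI[of _ "\<lambda>x. \<chi>' (\<chi> x)"] conjI)
      (simp_all add: inv image_image flip: ideal ideal' cls cls')
qed

section \<open>The sELA built from a representative cocycle\<close>

lemma sELA_of_simps:
  "vscale (sELA_of D \<Delta>) = vscale D" "bracket (sELA_of D \<Delta>) = bracket D"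
  "wscale (sELA_of D \<Delta>) = module_prod.scale (uscale D) (vscale D)"
  "wcarrier (sELA_of D \<Delta>) = ucarrier D \<times> ideal D" "anchor (sELA_of D \<Delta>) = snd"
  by (simp_all add: sELA_of_def Let_def)

locale representative =
  fixes D :: "('k::field, 'v::ab_group_add, 'u::ab_group_add) couple_data" and \<Delta>
  assumes data: "classifying_data D" and \<Delta>: "\<Delta> \<in> class2 D" and two_neq_zero: "(2::'k) \<noteq> 0"
begin

abbreviation "S \<equiv> sELA_of D \<Delta>"
abbreviation "jor u v \<equiv> bracket D u v + bracket D v u"

lemmas couple = leibniz_coupleD[OF classifying_dataD(1)[OF data]]
lemmas leibniz = leibniz_algebraD[OF couple(1)]
lemmas br = bilinear_intoD[OF leibniz(2)]

text \<open>Here \<open>vs1\<close> is the ambient space of \<open>U\<close>, \<open>vs2\<close> is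
  \<open>V\<close>, and \<open>p\<close> is their product with multiplication \<open>scale\<close>,
  which contains \<open>U \<oplus> i\<close> as a subspace.\<close>

sublocale vector_space_prod "uscale D" "vscale D"
  using classifying_dataD(2)[OF data] leibniz(1)
  by (simp add: vector_space_prod_def vector_space_pair_def)

lemma cocycle: "\<Delta> \<in> cocycles2 D (uscale D) (ucarrier D)"
  by (rule class2_eq_coh_class(2)[OF data \<Delta>])

lemma bilinear: "bilinear_into (vscale D) (uscale D) (ucarrier D) \<Delta>"
  and \<Delta>_commute: "\<Delta> u v = \<Delta> v u" and d2: "d2 D \<Delta> v0 v1 v2 = 0"
  using cocycle by (auto simp: cocycles2_def cochains2_def)

lemmas \<Delta>_simps = bilinear_intoD[OF bilinear]

lemma ideal_bracket: "x \<in> ideal D \<Longrightarrow> bracket D x y = 0"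
  using couple(5) by (auto simp: left_center_def)

lemma square_in_ideal: "bracket D x x \<in> ideal D"
proof -
  have "bracket D x x \<in> Sq D"
    unfolding Sq_def by (rule vs2.span_base) auto
  then show ?thesis using couple(4) by auto
qed

text \<open>By polarization \<open>jor u v\<close> is a combination of squares, all of which lie in
  the ideal.\<close>

lemma jor_in_ideal: "jor u v \<in> ideal D"
proof -
  have "jor u v = bracket D (u + v) (u + v) - bracket D u u - bracket D v v"
    by (simp add: br(2,3))
  then show ?thesis
    using square_in_ideal couple(2) by (simp add: vs2.subspace_diff)
qed

lemma eprod_S: "eprod S u v = (\<Delta> u v, vscale D (1/2) (jor u v))"
  by (simp add: sELA_of_def Let_def scale_def)

lemma sELA_S: "sELA S"
proof -
  have jor_add: "jor (u + u') v = jor u v + jor u' v" "jor u (v + v') = jor u v + jor u v'" for u u' v v'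
    by (simp_all add: br(2,3))
  have jor_scale: "jor (vscale D c u) v = vscale D c (jor u v)" "jor u (vscale D c v) = vscale D c (jor u v)" for c u v
    by (simp_all add: br(4,5) vs2.scale_right_distrib)
  have commute: "eprod S u v = eprod S v u" for u v
    by (simp add: eprod_S \<Delta>_commute[of u v] add.commute)
  have bil: "bilinear_into (vscale S) (wscale S) (wcarrier S) (eprod S)"
    unfolding sELA_of_simps
  proof (rule bilinear_intoI)
    show "eprod S u v \<in> ucarrier D \<times> ideal D" for u v
      by (simp add: eprod_S \<Delta>_simps(1) vs2.subspace_scale[OF couple(2)] jor_in_ideal)
  qed (simp_all add: eprod_S \<Delta>_simps(2-5) jor_add jor_scale vs2.scale_right_distrib scale_prod
      leibniz(1) p.vector_space_axioms mult.commute)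
  have sym: "eprod_sym S u v = eprod S u v" for u v
    using p.scale_half_double[OF two_neq_zero] by (simp add: eprod_sym_def commute[of v u] sELA_of_simps)
  have square: "eprod S u (bracket D v v) = eprod S v (bracket D u v)" for u v
  proof -
    \<comment> \<open>The cocycle identity at \<open>u\<close>, \<open>v\<close>, \<open>v\<close>
      gives twice the required equality; the outer halves cancel the doubling.\<close>
    have "uscale D (1/2) (\<Delta> u (bracket D v v) + \<Delta> u (bracket D v v))
        = uscale D (1/2) (\<Delta> v (bracket D u v) + \<Delta> v (bracket D u v))"
      using d2[of u v v] by (simp add: d2_def \<Delta>_commute[of "bracket D u v" v] algebra_simps)
    then have "\<Delta> u (bracket D v v) = \<Delta> v (bracket D u v)"
      by (simp only: vs1.scale_half_double[OF two_neq_zero])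
    \<comment> \<open>This is the Leibniz identity for \<open>u\<close>, \<open>v\<close>,
      \<open>v\<close>, because the square \<open>[v,v]\<close> annihilates \<open>u\<close> from
      the left.\<close>
    moreover have "jor u (bracket D v v) = jor v (bracket D u v)"
      using leibniz(3)[rule_format, of u v v] ideal_bracket[OF square_in_ideal]
      by (simp add: add.commute)
    ultimately show ?thesis by (simp add: eprod_S)
  qed
  show ?thesis
  proof (unfold sELA_def ELA_def sym, intro conjI)
    show "leibniz_algebra S"
      using couple(1) leibniz_algebra_cong[OF sELA_of_simps(1,2)] by blast
    show "vector_space (wscale S)"
      unfolding sELA_of_simps by (fact p.vector_space_axioms)
    show "module.subspace (wscale S) (wcarrier S)"
      unfolding sELA_of_simps by (rule subspace_Times[OF classifying_dataD(3)[OF data] couple(2)])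
    show "linear_on (wscale S) (vscale S) (wcarrier S) UNIV (anchor S)"
      unfolding sELA_of_simps by (rule linear_imp_linear_on[OF linear_snd]) simp
    show "\<forall>w\<in>wcarrier S. \<forall>v. bracket S (anchor S w) v = 0"
      using ideal_bracket by (auto simp: sELA_of_simps)
    \<comment> \<open>The first component vanishes since \<Delta> is zero on pairs from the ideal,
      the second since the ideal lies in the left center.\<close>
    show "\<forall>w\<in>wcarrier S. eprod S (anchor S w) (anchor S w) = 0"
      using classifying_dataD(5)[OF data] \<Delta> ideal_bracket
      by (auto simp: sELA_of_simps eprod_S zero_prod_def)
    show "\<forall>u v. eprod S u (bracket S v v) = eprod S v (bracket S u v)"
      unfolding sELA_of_simps using square by (intro allI)
    show "\<forall>v. bracket S v v = anchor S (eprod S v v)"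
      by (simp add: sELA_of_simps eprod_S vs2.scale_half_double[OF two_neq_zero])
    show "\<forall>u v. eprod S u v = eprod S v u"
      using commute by (intro allI)
  qed (fact bil)
qed

sublocale S: symmetric_ELA S
  by unfold_locales (fact sELA_S two_neq_zero)+

lemma ker_S: "ker_anchor S = ucarrier D \<times> {0}"
  using vs2.subspace_0[OF couple(2)] by (auto simp: ker_anchor_def sELA_of_simps)

lemma im_S: "im_anchor S = ideal D"
  using vs1.subspace_0[OF classifying_dataD(3)[OF data]] by (force simp: im_anchor_def sELA_of_simps)

text \<open>The inclusion of the second summand is a section, and its \<open>Delta_of\<close> is
  \<Delta> placed in the first coordinate.\<close>

lemma class2_data_of_S:
  "class2 (data_of S) = coh_class D scale (ucarrier D \<times> {0}) (\<lambda>u v. (\<Delta> u v, 0))"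
proof -
  let ?\<sigma> = "\<lambda>x. (0, x)"
  have "?\<sigma> \<in> sections S"
    using vs1.subspace_0[OF classifying_dataD(3)[OF data]]
    by (auto simp: sections_def linear_on_def im_S sELA_of_simps scale_prod)
  moreover have "Delta_of S ?\<sigma> = (\<lambda>u v. (\<Delta> u v, 0))"
    by (simp add: fun_eq_iff Delta_of_def eprod_S sELA_of_simps scale_prod)
  ultimately have "class2 (data_of S) = coh_class S (wscale S) (ker_anchor S) (\<lambda>u v. (\<Delta> u v, 0))"
    using S.coh_class_Delta_of[of ?\<sigma>] S.class2_data_of by simp
  also have "\<dots> = coh_class D (wscale S) (ker_anchor S) (\<lambda>u v. (\<Delta> u v, 0))"
    by (rule coh_class_cong) (simp_all add: sELA_of_simps)
  finally show ?thesis
    by (simp add: sELA_of_simps ker_S)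
qed

text \<open>The isomorphism is the identity on \<open>V\<close> and \<open>fst\<close> on the
  coefficients \<open>U \<times> {0}\<close>. The two inclusions between the classes come from
  \<open>coh_class_map\<close> for \<open>fst\<close> and for its inverse
  \<open>u \<mapsto> (u, 0)\<close>.\<close>

lemma data_iso_data_of_S: "data_iso (data_of S) D"
proof -
  have lin: "Vector_Spaces.linear (uscale D) scale (\<lambda>u. (u, 0))"
    by (simp add: Vector_Spaces.linear_iff vs1.vector_space_axioms p.vector_space_axioms scale_prod)
  have "(\<lambda>X x y. fst (X x y)) ` class2 (data_of S) = class2 D"
  proof (intro equalityI subsetI)
    fix Y assume "Y \<in> (\<lambda>X x y. fst (X x y)) ` class2 (data_of S)"
    then obtain X where X: "X \<in> class2 (data_of S)" "Y = (\<lambda>x y. fst (X x y))"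
      by (elim imageE)
    have "Y \<in> coh_class D (uscale D) (ucarrier D) (\<lambda>u v. fst (\<Delta> u v, 0::'v))"
      unfolding X(2) by (rule coh_class_map[OF linear_fst _ X(1)[unfolded class2_data_of_S]]) auto
    then show "Y \<in> class2 D"
      by (simp add: class2_eq_coh_class(1)[OF data \<Delta>])
  next
    fix Y assume "Y \<in> class2 D"
    then have Y: "Y \<in> coh_class D (uscale D) (ucarrier D) \<Delta>"
      by (simp add: class2_eq_coh_class(1)[OF data \<Delta>])
    have "(\<lambda>u v. (Y u v, 0)) \<in> class2 (data_of S)"
      unfolding class2_data_of_S by (rule coh_class_map[OF lin _ Y]) auto
    then show "Y \<in> (\<lambda>X x y. fst (X x y)) ` class2 (data_of S)"
      by (rule rev_image_eqI) simp
  qed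
  moreover have "linear_iso_on (vscale D) (vscale D) UNIV UNIV id"
    by (simp add: linear_iso_on_def linear_on_def)
  moreover have "linear_on scale (uscale D) (ucarrier D \<times> {0}) (ucarrier D) fst"
    by (rule linear_imp_linear_on[OF linear_fst]) auto
  then have "linear_iso_on scale (uscale D) (ucarrier D \<times> {0}) (ucarrier D) fst"
    by (simp add: linear_iso_on_def bij_betw_def inj_on_def)
  ultimately show ?thesis
    unfolding data_iso_def S.data_of_simps im_S ker_S sELA_of_simps
    by (intro exI[of _ id] exI[of _ fst] conjI) simp_all
qed

end

section \<open>Symmetrization of a general ELA\<close>

lemma ELA_symmetrization:
  fixes A :: "('k::field, 'v::ab_group_add, 'w::ab_group_add) enhanced"
  assumes "ELA A" and two: "(2::'k) \<noteq> 0"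
  shows "sELA (symmetrization A)"
    and "\<exists>!\<beta>. \<beta> \<in> alternating_forms A \<and>
          (\<forall>u v. eprod A u v = eprod (symmetrization A) u v + \<beta> u v)"
proof -
  note A = ELAD[OF assms(1)]
  interpret W: vector_space "wscale A" by (rule A(2))
  note V = leibniz_algebraD(1)[OF A(1)]
  note eprod = bilinear_intoD[OF A(5)]
  have half: "wscale A (1/2) (x + x) = x" for x
    by (rule W.scale_half_double[OF two])
  have mem: "eprod_sym A u v \<in> wcarrier A" for u v
    by (simp add: eprod_sym_def W.subspace_scale[OF A(3)] W.subspace_add[OF A(3)] eprod)
  have diag: "eprod_sym A v v = eprod A v v" for v
    by (simp add: eprod_sym_def half)
  have bil: "bilinear_into (vscale A) (wscale A) (wcarrier A) (eprod_sym A)"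
    by (rule bilinear_intoI[OF V A(2)])
      (simp_all add: mem, simp_all add: eprod_sym_def eprod(2-5) W.scale_right_distrib ac_simps)
  have comm: "eprod_sym A u v = eprod_sym A v u" for u v
    by (simp add: eprod_sym_def add.commute)
  have simps: "vscale (symmetrization A) = vscale A" "bracket (symmetrization A) = bracket A"
    "wscale (symmetrization A) = wscale A" "wcarrier (symmetrization A) = wcarrier A"
    "anchor (symmetrization A) = anchor A" "eprod (symmetrization A) = eprod_sym A"
    by (simp_all add: symmetrization_def)
  have idem: "eprod_sym (symmetrization A) u v = eprod_sym A u v" for u v
    by (simp only: eprod_sym_def[of "symmetrization A"] simps comm[of v u] half)
  have "leibniz_algebra (symmetrization A)"
    using A(1) leibniz_algebra_cong[OF simps(1,2)] by blast
  \<comment> \<open>Two axioms involve the product only on the diagonal, where symmetrizing changes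
    nothing; the remaining one uses \<open>eprod_sym\<close>, which is idempotent.\<close>
  then have "ELA (symmetrization A)"
    unfolding ELA_def idem unfolding simps diag
    by (intro conjI A bil)
  then show "sELA (symmetrization A)"
    using comm by (simp add: sELA_def simps)
  \<comment> \<open>The antisymmetric part of the product; the required equation forces this choice,
    which gives uniqueness.\<close>
  define \<beta> where "\<beta> u v = eprod A u v - eprod_sym A u v" for u v
  have "bilinear_into (vscale A) (wscale A) (wcarrier A) \<beta>"
    using bilinear_intoD[OF bil] eprod
    by (intro bilinear_intoI V A(2))
      (simp_all add: \<beta>_def W.subspace_diff[OF A(3)] W.scale_right_diff_distrib)
  then have "\<beta> \<in> alternating_forms A"
    by (simp add: alternating_forms_def \<beta>_def diag)
  then show "\<exists>!\<beta>. \<beta> \<in> alternating_forms A \<and>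
          (\<forall>u v. eprod A u v = eprod (symmetrization A) u v + \<beta> u v)"
    unfolding simps by (intro ex1I[of _ \<beta>]) (auto simp: \<beta>_def fun_eq_iff)
qed

section \<open>The correspondence\<close>

lemma sELA_iso_iff_data_iso:
  fixes E :: "('k::field, 'v::ab_group_add, 'w::ab_group_add) enhanced"
    and E' :: "('k, 'v'::ab_group_add, 'w'::ab_group_add) enhanced"
  assumes "(2::'k) \<noteq> 0" "sELA E" "sELA E'"
  shows "sELA_iso E E' \<longleftrightarrow> data_iso (data_of E) (data_of E')"
proof -
  have "symmetric_ELA E" "symmetric_ELA E'"
    using assms by (simp_all add: symmetric_ELA_def)
  then show ?thesis
    using sELA_iso_imp_data_iso data_iso_imp_sELA_iso by blast
qed

lemma sELA_of_data:
  fixes D :: "('k::field, 'v::ab_group_add, 'u::ab_group_add) couple_data"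
  assumes "(2::'k) \<noteq> 0" "classifying_data D" "\<Delta> \<in> class2 D"
  shows "sELA (sELA_of D \<Delta>)" "data_iso (data_of (sELA_of D \<Delta>)) D"
proof -
  interpret representative D \<Delta>
    using assms by (simp add: representative_def)
  show "sELA (sELA_of D \<Delta>)" by (rule sELA_S)
  show "data_iso (data_of (sELA_of D \<Delta>)) D" by (rule data_iso_data_of_S)
qed

lemma data_of_sELA:
  fixes E :: "('k::field, 'v::ab_group_add, 'w::ab_group_add) enhanced"
  assumes two: "(2::'k) \<noteq> 0" and E: "sELA E"
  shows "leibniz_couple E (im_anchor E)" "sections E \<noteq> {}"
    and "\<sigma> \<in> sections E \<Longrightarrow> Delta_of E \<sigma> u v \<in> ker_anchor E"
    and "\<sigma> \<in> sections E \<Longrightarrow> Delta_of E \<sigma> \<in> cocycles2 E (wscale E) (ker_anchor E)"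
    and "\<sigma> \<in> sections E \<Longrightarrow> m \<in> im_anchor E \<Longrightarrow> n \<in> im_anchor E \<Longrightarrow> Delta_of E \<sigma> m n = 0"
    and "\<sigma> \<in> sections E \<Longrightarrow>
      coh_class E (wscale E) (ker_anchor E) (Delta_of E \<sigma>) = class2 (data_of E)"
    and "classifying_data (data_of E)"
proof -
  interpret symmetric_ELA E
    using assms by (simp add: symmetric_ELA_def)
  show "leibniz_couple E (im_anchor E)" "sections E \<noteq> {}" "classifying_data (data_of E)"
    by (fact leibniz_couple sections_nonempty classifying_data_data_of)+
  show "\<sigma> \<in> sections E \<Longrightarrow> Delta_of E \<sigma> u v \<in> ker_anchor E"
    by (rule Delta_of_in_K)
  show "\<sigma> \<in> sections E \<Longrightarrow> Delta_of E \<sigma> \<in> cocycles2 E (wscale E) (ker_anchor E)"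
    by (rule Delta_of_cocycle)
  show "\<sigma> \<in> sections E \<Longrightarrow> m \<in> im_anchor E \<Longrightarrow> n \<in> im_anchor E \<Longrightarrow> Delta_of E \<sigma> m n = 0"
    by (rule Delta_of_I)
  show "\<sigma> \<in> sections E \<Longrightarrow>
      coh_class E (wscale E) (ker_anchor E) (Delta_of E \<sigma>) = class2 (data_of E)"
    by (simp only: coh_class_Delta_of class2_data_of)
qed

text \<open>The round trip on data, applied to \<open>data_of E\<close>, shows that both sELAs have
  isomorphic data, and that already makes them isomorphic.\<close>

lemma sELA_iso_sELA_of_data_of:
  fixes E :: "('k::field, 'v::ab_group_add, 'w::ab_group_add) enhanced"
  assumes two: "(2::'k) \<noteq> 0" and E: "sELA E" and \<Delta>: "\<Delta> \<in> class2 (data_of E)"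
  shows "sELA_iso (sELA_of (data_of E) \<Delta>) E"
  using sELA_of_data[OF two data_of_sELA(7)[OF two E] \<Delta>] sELA_iso_iff_data_iso[OF two _ E]
  by blast

text \<open>Both sELAs return their own data up to isomorphism, so the claim transfers along these
  isomorphisms by symmetry and transitivity. For \<open>D = D'\<close> it contains the independence
  of the chosen representative.\<close>

lemma sELA_iso_sELA_of_iff:
  fixes D :: "('k::field, 'v::ab_group_add, 'u::ab_group_add) couple_data"
    and D' :: "('k, 'v'::ab_group_add, 'u'::ab_group_add) couple_data"
  assumes two: "(2::'k) \<noteq> 0" and D: "classifying_data D" "\<Delta> \<in> class2 D"
    and D': "classifying_data D'" "\<Delta>' \<in> class2 D'"
  shows "sELA_iso (sELA_of D \<Delta>) (sELA_of D' \<Delta>') \<longleftrightarrow> data_iso D D'"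
proof -
  note S = sELA_of_data[OF two D] and S' = sELA_of_data[OF two D']
  have "data_iso D (data_of (sELA_of D \<Delta>))" "data_iso D' (data_of (sELA_of D' \<Delta>'))"
    using data_iso_sym[OF data_of_sELA(7)[OF two S(1)] S(2)]
      data_iso_sym[OF data_of_sELA(7)[OF two S'(1)] S'(2)] by simp_all
  then show ?thesis
    unfolding sELA_iso_iff_data_iso[OF two S(1) S'(1)]
    using S(2) S'(2) data_iso_trans by metis
qed

theorem theorem2p14:
  assumes char_ne_2: "CHAR('k::field) \<noteq> 2"
  shows
    \<comment> \<open>(1) from sELAs to data\<close>
    "(\<forall>E :: ('k, 'v::ab_group_add, 'w::ab_group_add) enhanced. sELA E \<longrightarrow>
        leibniz_couple E (im_anchor E) \<and>
        sections E \<noteq> {} \<and>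
        (\<forall>\<sigma>\<in>sections E.
           (\<forall>u v. Delta_of E \<sigma> u v \<in> ker_anchor E) \<and>
           Delta_of E \<sigma> \<in> cocycles2 E (wscale E) (ker_anchor E) \<and>
           (\<forall>m\<in>im_anchor E. \<forall>n\<in>im_anchor E. Delta_of E \<sigma> m n = 0) \<and>
           coh_class E (wscale E) (ker_anchor E) (Delta_of E \<sigma>) = class2 (data_of E)) \<and>
        classifying_data (data_of E))
   \<and>
    \<comment> \<open>(2) from data to sELAs, and the two round trips\<close>
    (\<forall>D :: ('k, 'v, 'u::ab_group_add) couple_data. classifying_data D \<longrightarrow>
        (\<forall>\<Delta>\<in>class2 D. sELA (sELA_of D \<Delta>) \<and> data_iso (data_of (sELA_of D \<Delta>)) D))
   \<and>
    (\<forall>E :: ('k, 'v, 'w) enhanced. sELA E \<longrightarrow>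
        (\<forall>\<Delta>\<in>class2 (data_of E). sELA_iso (sELA_of (data_of E) \<Delta>) E))
   \<and>
    \<comment> \<open>both constructions descend to isomorphism classes\<close>
    (\<forall>(E :: ('k, 'v, 'w) enhanced) (E' :: ('k, 'v'::ab_group_add, 'w'::ab_group_add) enhanced).
        sELA E \<and> sELA E' \<longrightarrow> (sELA_iso E E' \<longleftrightarrow> data_iso (data_of E) (data_of E')))
   \<and>
    (\<forall>(D :: ('k, 'v, 'u) couple_data) (D' :: ('k, 'v', 'u'::ab_group_add) couple_data).
        classifying_data D \<and> classifying_data D' \<longrightarrow>
        (\<forall>\<Delta>\<in>class2 D. \<forall>\<Delta>'\<in>class2 D'.
           sELA_iso (sELA_of D \<Delta>) (sELA_of D' \<Delta>') \<longleftrightarrow> data_iso D D'))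
   \<and>
    \<comment> \<open>(3) general ELAs\<close>
    (\<forall>A :: ('k, 'v, 'w) enhanced. ELA A \<longrightarrow>
        sELA (symmetrization A) \<and>
        (\<exists>!\<beta>. \<beta> \<in> alternating_forms A \<and>
              (\<forall>u v. eprod A u v = eprod (symmetrization A) u v + \<beta> u v)))"
proof -
  have two: "(2::'k) \<noteq> 0"
    by (rule two_neq_zero_if_CHAR[OF char_ne_2])
  show ?thesis
    by (intro conjI allI impI ballI; (elim conjE)?)
      (rule data_of_sELA[OF two] sELA_of_data[OF two] sELA_iso_sELA_of_data_of[OF two]
        sELA_iso_iff_data_iso[OF two] sELA_iso_sELA_of_iff[OF two] ELA_symmetrization[OF _ two];
        assumption)+
qed

end
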